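(* Let $a,b>0$ be real numbers. Let $\mathcal{B}_{a,b}$ be the family of all rectangles $R\subset\mathbb{R}^2$ whose eccentricity $e_R$ and orientation $\omega_R$ satisfy $$\left(e_R,\omega_R\right)=\left(\frac{1}{n^a},\frac{\pi}{4n^b}\right)$$ for some integer $n\geq 1$, and let $M_{a,b}:=M_{\mathcal{B}_{a,b}}$ be the associated geometric maximal operator. If $a\leq b$, then $M_{a,b}$ is a good operator, i.e. it is bounded on $L^p(\mathbb{R}^2)$ for every $p>1$. If $a>b$, then $M_{a,b}$ is a bad operator, i.e. it is unbounded on $L^p(\mathbb{R}^2)$ for every $1<p<\infty$.
   Context: $|A|$ denotes the Lebesgue measure of a measurable set $A\subset\mathbb{R}^2$. For a (nondegenerate) rectangle $R\subset\mathbb{R}^2$, its orientation $\omega_R\in[0,\pi)$ is the angle its longest side makes with the $Ox$-axis (for a square either side direction may be taken as the longest one), and its eccentricity $e_R\in(0,1]$ is the ratio of its shortest side to its longest side. For a non-empty family $\mathcal{B}$ of rectangles, set $$\mathcal{B}^*=\{\vec t+hR:\ \vec t\in\mathbb{R}^2,\ h>0,\ R\in\mathcal{B}\},$$ and define the geometric maximal operator generated by $\mathcal{B}$ by $$M_{\mathcal{B}}f(x)=\sup_{x\in R\in\mathcal{B}^*}\frac{1}{|R|}\int_R|f|,\qquad f\in L^1_{loc}(\mathbb{R}^2),\ x\in\mathbb{R}^2.$$ For $p\in(1,\infty]$ let $\|M_{\mathcal{B}}\|_p=\sup_{\|f\|_p=1}\|M_{\mathcal{B}}f\|_p$; $M_{\mathcal{B}}$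 is bounded on $L^p(\mathbb{R}^2)$ if $\|M_{\mathcal{B}}\|_p<\infty$ and unbounded otherwise. *)

theory Defs
  imports "HOL-Analysis.Analysis" "HOL-Probability.Essential_Supremum"
begin

type_synonym plane = "real \<times> real"

section \<open>Rectangles\<close>

text \<open>The closed rectangle with a corner at \<open>c\<close>, whose sides from that corner have length \<open>l\<close> in
  the direction at angle \<open>w\<close> with the horizontal axis and length \<open>s\<close> in the perpendicular one.\<close>

definition rectangle :: "plane \<Rightarrow> real \<Rightarrow> real \<Rightarrow> real \<Rightarrow> plane set" where
  "rectangle c w l s =
     {c + u *\<^sub>R (cos w, sin w) + v *\<^sub>R (- sin w, cos w) | u v. 0 \<le> u \<and> u \<le> l \<and> 0 \<le> v \<and> v \<le> s}"

text \<open>\<open>R\<close> is a nondegenerate rectangle with eccentricity \<open>e\<close> (shortest side over longest side) and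
  orientation \<open>w\<close> (angle of the longest side). This is a relation rather than a pair of
  functions of \<open>R\<close> because a square has two admissible orientations.\<close>

definition has_ecc_orient :: "plane set \<Rightarrow> real \<Rightarrow> real \<Rightarrow> bool" where
  "has_ecc_orient R e w \<longleftrightarrow> 0 \<le> w \<and> w < pi \<and>
     (\<exists>c l s. 0 < s \<and> s \<le> l \<and> R = rectangle c w l s \<and> e = s / l)"

definition rect_family :: "real \<Rightarrow> real \<Rightarrow> plane set set" where
  "rect_family a b =
     {R. \<exists>n::nat. n \<ge> 1 \<and> has_ecc_orient R (1 / real n powr a) (pi / (4 * real n powr b))}"

section \<open>Geometric maximal operators\<close>

definition homothets :: "plane set set \<Rightarrow> plane set set" where
  "homothets B = {(\<lambda>y. t + h *\<^sub>R y) ` R | t h R. h > 0 \<and> R \<in> B}"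

text \<open>Values are extended, since the supremum may be infinite at some points.\<close>

definition maximal_op :: "plane set set \<Rightarrow> (plane \<Rightarrow> real) \<Rightarrow> plane \<Rightarrow> ennreal" where
  "maximal_op B f x =
     (SUP R \<in> {R \<in> homothets B. x \<in> R}.
        (\<integral>\<^sup>+ y \<in> R. ennreal \<bar>f y\<bar> \<partial>lebesgue) / emeasure lebesgue R)"

section \<open>Norms\<close>

text \<open>Power with a positive real exponent on \<open>[0,\<infinity>]\<close>.\<close>

definition epowr :: "ennreal \<Rightarrow> real \<Rightarrow> ennreal" where
  "epowr t r = (if t = \<infinity> then \<infinity> else ennreal (enn2real t powr r))"

definition Lp_norm :: "ennreal \<Rightarrow> (plane \<Rightarrow> ennreal) \<Rightarrow> ennreal" where
  "Lp_norm p g =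
     (if p = \<infinity> then esssup lebesgue g
      else epowr (\<integral>\<^sup>+ x. epowr (g x) (enn2real p) \<partial>lebesgue) (1 / enn2real p))"

text \<open>For \<open>p \<ge> 1\<close>, the functions over which the supremum is taken are automatically locally
  integrable.\<close>

definition op_norm :: "ennreal \<Rightarrow> ((plane \<Rightarrow> real) \<Rightarrow> plane \<Rightarrow> ennreal) \<Rightarrow> ennreal" where
  "op_norm p T =
     (SUP f \<in> {f. f \<in> borel_measurable lebesgue \<and> Lp_norm p (\<lambda>x. ennreal \<bar>f x\<bar>) = 1}.
        Lp_norm p (T f))"

definition bounded_on_Lp :: "ennreal \<Rightarrow> ((plane \<Rightarrow> real) \<Rightarrow> plane \<Rightarrow> ennreal) \<Rightarrow> bool" where
  "bounded_on_Lp p T \<longleftrightarrow> op_norm p T < \<infinity>"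

end

theory Submission
  imports Defs
begin

text \<open>If \<open>a \<le> b\<close>, the orientation of a rectangle is at most a multiple of its eccentricity, so the
  rectangle lies in a box with sides parallel to the axes and comparable area. Hence the operator is dominated by
  the strong maximal operator, which is bounded on \<open>L\<^sup>p\<close> because the one-dimensional Hardy--Littlewood
  operator is. For \<open>p = \<infinity>\<close> one also needs measurability: superlevel sets are open since a rectangle
  can be slightly enlarged.

  If \<open>a > b\<close>, then for every \<open>N\<close> the slopes of the rectangles with large index \<open>n\<close> contain, up to scaling and
  errors that the thinness of the rectangles tolerates, all multiples of \<open>2\<^sup>-\<^sup>N\<close> in \<open>[0,1]\<close>. An explicit
  Kakeya construction with these slopes gives \<open>2\<^sup>N\<close> tubes whose union \<open>K\<close> over \<open>0 \<le> x \<le> 1\<close> has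
  measure \<open>O(1 / N)\<close>, while their continuations to \<open>2 \<le> x \<le> 3\<close> are disjoint of total measure at
  least a constant. The maximal function of the indicator of \<open>K\<close> is at least \<open>1 / 6\<close> on these continuations.\<close>

section \<open>Interpolation\<close>

text \<open>The strong maximal operator is not of weak type (1,1), so interpolation is done only for
  the one-dimensional operator, and the resulting \<open>L\<^sup>q\<close> bound is used once per
  coordinate. For \<open>a > b\<close> two limits carry the argument: consecutive angles have ratio
  tending to 1, and the eccentricity is negligible against the angle. The first makes the slopes
  dense relative to their size, the second makes the rectangles thin enough, and both hold to any
  relative precision \<open>2^(-N)\<close> once the starting index is large. That starting index
  fixes a scale \<open>t\<close>, possibly tiny. The family is not invariant under vertical scaling,
  but the Kakeya figure may be flattened by \<open>t\<close>: the measures of \<open>K\<close> and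
  of the continuations both carry the factor \<open>t\<close>, which cancels in their ratio. What
  remains forces the \<open>q\<close>-th power of the operator norm on \<open>L\<^sup>q\<close> to
  be at least \<open>N / (84 * 6 powr q)\<close>, with \<open>N\<close> arbitrary.\<close>

lemma epowr_ennreal: "0 \<le> t \<Longrightarrow> epowr (ennreal t) r = ennreal (t powr r)"
  by (simp add: epowr_def)

lemma epowr_mono:
  assumes "s \<le> t" "0 \<le> r"
  shows "epowr s r \<le> epowr t r"
  using assms by (cases s; cases t) (auto simp: epowr_def powr_mono2 top_unique)

lemma epowr_mult_const:
  assumes "0 < c" "0 < r"
  shows "epowr (ennreal c * t) r = ennreal (c powr r) * epowr t r"
proof (cases t)
  case (real x)
  then show ?thesis
    using assms by (simp add: epowr_ennreal powr_mult flip: ennreal_mult)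
next
  case top
  then show ?thesis
    using assms by (simp add: epowr_def ennreal_mult_top)
qed

lemma epowr_finite: "t < \<infinity> \<Longrightarrow> epowr t r < \<infinity>"
  by (auto simp: epowr_def)

lemma epowr_one: "epowr 1 r = 1"
  by (simp add: epowr_def)

lemma epowr_epowr_inverse:
  assumes "0 < r"
  shows "epowr (epowr t r) (1 / r) = t"
proof (cases t)
  case (real x)
  then show ?thesis
    using assms by (simp add: epowr_ennreal powr_powr)
qed (simp add: epowr_def)

lemma mult_epowr:
  assumes "1 < q"
  shows "t * epowr t (q - 1) = epowr t q"
proof (cases t)
  case (real x)
  moreover have "x * x powr (q - 1) = x powr q"
    using real powr_add[of x 1 "q - 1"] by simp
  ultimately show ?thesis
    using assms by (simp add: epowr_ennreal flip: ennreal_mult)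
qed (simp add: epowr_def)

lemma measurable_epowr [measurable]:
  assumes [measurable]: "f \<in> borel_measurable M"
  shows "(\<lambda>x. epowr (f x) r) \<in> borel_measurable M"
  unfolding epowr_def by measurable

lemma nn_integral_powr_from_0:
  fixes r T :: real
  assumes "0 < r" "0 \<le> T"
  shows "(\<integral>\<^sup>+ s. ennreal (s powr (r - 1)) * indicator {s. 0 < s \<and> s < T} s \<partial>lborel) = ennreal (T powr r / r)"
proof -
  have "(\<integral>\<^sup>+ s. ennreal (s powr (r - 1)) * indicator {s. 0 < s \<and> s < T} s \<partial>lborel)
      = (\<integral>\<^sup>+ s. ennreal (s powr (r - 1)) * indicator {0..T} s \<partial>lborel)"
    by (intro nn_integral_cong_AE)
      (use AE_lborel_singleton[of 0] AE_lborel_singleton[of T] in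
        \<open>eventually_elim, auto simp: indicator_def\<close>)
  also have "\<dots> = ennreal (T powr (r - 1 + 1) / (r - 1 + 1))"
    by (rule nn_integral_has_integral_lebesgue'[OF _ has_integral_powr_from_0])
      (use assms in auto)
  finally show ?thesis by simp
qed

text \<open>\<open>s powr r / r\<close> is a primitive of \<open>s powr (r - 1)\<close>. Keeping the
  condition \<open>s < t\<close> as an indicator in \<open>s\<close> lets Fubini turn the integral
  of a power into an integral over superlevel sets.\<close>

lemma epowr_layer_cake:
  fixes r :: real and t :: ennreal
  assumes r: "0 < r"
  shows "(\<integral>\<^sup>+ s. ennreal (s powr (r - 1)) * indicator {s. 0 < s \<and> ennreal s < t} s \<partial>lborel)
           = ennreal (1 / r) * epowr t r"
proof (cases t)
  case (real T)
  have "(\<integral>\<^sup>+ s. ennreal (s powr (r - 1)) * indicator {s. 0 < s \<and> ennreal s < t} s \<partial>lborel)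
      = (\<integral>\<^sup>+ s. ennreal (s powr (r - 1)) * indicator {s. 0 < s \<and> s < T} s \<partial>lborel)"
    using real by (intro nn_integral_cong) (auto simp: indicator_def ennreal_less_iff)
  then show ?thesis
    using nn_integral_powr_from_0[OF r, of T] real r
    by (simp add: epowr_ennreal flip: ennreal_mult)
next
  case top
  let ?I = "\<integral>\<^sup>+ s. ennreal (s powr (r - 1)) * indicator {s. 0 < s \<and> ennreal s < t} s \<partial>lborel"
  have *: "ennreal B \<le> ?I" if "0 \<le> B" for B
  proof -
    \<comment> \<open>Chosen so that the integral up to \<open>T\<close> is exactly
      \<open>B\<close>; for infinite \<open>t\<close> the full integral thus exceeds every
      real.\<close>
    define T where "T = (B * r) powr (1 / r)"
    have "ennreal B = ennreal (T powr r / r)"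
      using r that by (simp add: T_def powr_powr)
    also have "\<dots> = (\<integral>\<^sup>+ s. ennreal (s powr (r - 1)) * indicator {s. 0 < s \<and> s < T} s \<partial>lborel)"
      using nn_integral_powr_from_0[OF r, of T] by (simp add: T_def)
    also have "\<dots> \<le> ?I"
      using top by (intro nn_integral_mono) (auto simp: indicator_def)
    finally show ?thesis .
  qed
  have "?I = \<infinity>"
  proof (cases ?I)
    case (real x)
    then show ?thesis
      using *[of "x + 1"] by simp
  qed simp
  then show ?thesis
    using r top by (simp add: epowr_def ennreal_mult_top)
qed

text \<open>Marcinkiewicz interpolation between \<open>L\<^sup>\<infinity>\<close> and weak \<open>L\<^sup>1\<close>: only the part of \<open>f\<close> above half of the
  level \<open>s\<close> contributes to the set where the maximal function exceeds \<open>s\<close>.\<close>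

lemma weak_type_interpolation:
  fixes f g :: "'a \<Rightarrow> ennreal" and C q :: real
  assumes M: "sigma_finite_measure M"
    and f [measurable]: "f \<in> borel_measurable M"
    and g [measurable]: "g \<in> borel_measurable M"
    and C: "0 < C" and q: "1 < q"
    and weak: "\<And>s. 0 < s \<Longrightarrow> ennreal s * emeasure M {x \<in> space M. ennreal s < g x}
       \<le> ennreal C * (\<integral>\<^sup>+ x. f x * indicator {x. ennreal s < 2 * f x} x \<partial>M)"
  shows "(\<integral>\<^sup>+ x. epowr (g x) q \<partial>M)
    \<le> ennreal (C * q * 2 powr (q - 1) / (q - 1)) * (\<integral>\<^sup>+ x. epowr (f x) q \<partial>M)"
proof -
  interpret M: sigma_finite_measure M by fact
  interpret P: pair_sigma_finite lborel M ..
  interpret P': pair_sigma_finite M "lborel :: real measure" ..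
  have "(\<integral>\<^sup>+ x. epowr (g x) q \<partial>M)
      = ennreal q * (\<integral>\<^sup>+ x. ennreal (1 / q) * epowr (g x) q \<partial>M)"
    using q by (simp add: nn_integral_cmult mult.assoc[symmetric] flip: ennreal_mult)
  also have "(\<integral>\<^sup>+ x. ennreal (1 / q) * epowr (g x) q \<partial>M)
      = (\<integral>\<^sup>+ x. \<integral>\<^sup>+ s. ennreal (s powr (q - 1)) * indicator {s. 0 < s \<and> ennreal s < g x} s \<partial>lborel \<partial>M)"
    using q by (simp add: epowr_layer_cake)
  also have "\<dots> = (\<integral>\<^sup>+ s. \<integral>\<^sup>+ x. ennreal (s powr (q - 1)) * indicator {s. 0 < s \<and> ennreal s < g x} s \<partial>M \<partial>lborel)"
    by (rule P.Fubini') measurable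
  also have "\<dots> \<le> (\<integral>\<^sup>+ s. \<integral>\<^sup>+ x. ennreal C * f x *
      (ennreal (s powr (q - 1 - 1)) * indicator {s. 0 < s \<and> ennreal s < 2 * f x} s) \<partial>M \<partial>lborel)"
  proof (rule nn_integral_mono)
    fix s :: real
    show "(\<integral>\<^sup>+ x. ennreal (s powr (q - 1)) * indicator {s. 0 < s \<and> ennreal s < g x} s \<partial>M)
      \<le> (\<integral>\<^sup>+ x. ennreal C * f x *
          (ennreal (s powr (q - 1 - 1)) * indicator {s. 0 < s \<and> ennreal s < 2 * f x} s) \<partial>M)"
    proof (cases "0 < s")
      case True
      \<comment> \<open>One factor \<open>s\<close> is split off to form the left-hand side of
        \<open>weak\<close>; the remaining exponent \<open>q - 2\<close> is kept as
        \<open>q - 1 - 1\<close> to match the layer cake formula with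
        \<open>r = q - 1\<close>.\<close>
      have s: "s powr (q - 1) = s powr (q - 1 - 1) * s"
        using True powr_add[of s "q - 1 - 1" 1] by simp
      have "(\<integral>\<^sup>+ x. ennreal (s powr (q - 1)) * indicator {s. 0 < s \<and> ennreal s < g x} s \<partial>M)
         = (\<integral>\<^sup>+ x. ennreal (s powr (q - 1)) * indicator {x \<in> space M. ennreal s < g x} x \<partial>M)"
        using True by (intro nn_integral_cong) (auto simp: indicator_def)
      also have "\<dots> = ennreal (s powr (q - 1 - 1)) * (ennreal s * emeasure M {x \<in> space M. ennreal s < g x})"
        using True by (subst nn_integral_cmult_indicator) (simp_all add: s ennreal_mult mult.assoc)
      also have "\<dots> \<le> ennreal (s powr (q - 1 - 1)) *
          (ennreal C * (\<integral>\<^sup>+ x. f x * indicator {x. ennreal s < 2 * f x} x \<partial>M))"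
        by (intro mult_left_mono weak True) simp
      also have "\<dots> = (\<integral>\<^sup>+ x. ennreal (s powr (q - 1 - 1)) * (ennreal C * (f x * indicator {x. ennreal s < 2 * f x} x)) \<partial>M)"
        by (simp add: nn_integral_cmult)
      also have "\<dots> = (\<integral>\<^sup>+ x. ennreal C * f x *
          (ennreal (s powr (q - 1 - 1)) * indicator {s. 0 < s \<and> ennreal s < 2 * f x} s) \<partial>M)"
        using True by (intro nn_integral_cong) (simp add: indicator_def mult_ac)
      finally show ?thesis .
    qed simp
  qed
  also have "\<dots> = (\<integral>\<^sup>+ x. \<integral>\<^sup>+ s. ennreal C * f x *
      (ennreal (s powr (q - 1 - 1)) * indicator {s. 0 < s \<and> ennreal s < 2 * f x} s) \<partial>lborel \<partial>M)"
    by (rule P'.Fubini') measurable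
  \<comment> \<open>With the order exchanged, \<open>s\<close> runs up to \<open>2 * f x\<close> and
    its integral is \<open>(2 * f x) powr (q - 1) / (q - 1)\<close>; convergence at 0 is where
    \<open>1 < q\<close> matters.\<close>
  also have "\<dots> = (\<integral>\<^sup>+ x. ennreal (C * 2 powr (q - 1) / (q - 1)) * epowr (f x) q \<partial>M)"
  proof (intro nn_integral_cong)
    fix x
    have "(\<integral>\<^sup>+ s. ennreal C * f x *
        (ennreal (s powr (q - 1 - 1)) * indicator {s. 0 < s \<and> ennreal s < 2 * f x} s) \<partial>lborel)
      = ennreal C * f x * (ennreal (1 / (q - 1)) * epowr (ennreal 2 * f x) (q - 1))"
      using q by (subst nn_integral_cmult, simp, subst epowr_layer_cake) simp_all
    also have "\<dots> = ennreal C * (ennreal (1 / (q - 1)) * ennreal (2 powr (q - 1))) * (f x * epowr (f x) (q - 1))"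
      using q by (simp only: epowr_mult_const[of 2 "q - 1"]) (simp add: mult_ac)
    also have "\<dots> = ennreal (C * 2 powr (q - 1) / (q - 1)) * epowr (f x) q"
      using C q by (simp add: mult_epowr flip: ennreal_mult)
    finally show "(\<integral>\<^sup>+ s. ennreal C * f x *
        (ennreal (s powr (q - 1 - 1)) * indicator {s. 0 < s \<and> ennreal s < 2 * f x} s) \<partial>lborel)
      = ennreal (C * 2 powr (q - 1) / (q - 1)) * epowr (f x) q" .
  qed
  also have "ennreal q * (\<integral>\<^sup>+ x. ennreal (C * 2 powr (q - 1) / (q - 1)) * epowr (f x) q \<partial>M)
      = ennreal (C * q * 2 powr (q - 1) / (q - 1)) * (\<integral>\<^sup>+ x. epowr (f x) q \<partial>M)"
  proof -
    have "C * q * 2 powr (q - 1) / (q - 1) = q * (C * 2 powr (q - 1) / (q - 1))"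
      by simp
    then have "ennreal (C * q * 2 powr (q - 1) / (q - 1)) = ennreal q * ennreal (C * 2 powr (q - 1) / (q - 1))"
      using C q by (simp only:) (rule ennreal_mult, auto)
    then show ?thesis
      by (subst nn_integral_cmult) (simp_all add: mult.assoc)
  qed
  finally show ?thesis
    using q by (simp add: mult_left_mono)
qed

section \<open>The strong maximal operator\<close>

text \<open>The restriction to rational endpoints makes the supremum countable, hence measurable even in
  additional parameters; it costs a factor 2 in \<open>hl_maximal_ge\<close> below.\<close>

definition hl_maximal :: "(real \<Rightarrow> ennreal) \<Rightarrow> real \<Rightarrow> ennreal" where
  "hl_maximal f x = (SUP (u, v) \<in> {(u, v). u \<in> \<rat> \<and> v \<in> \<rat> \<and> u < v}.
     indicator {u..v} x * ((\<integral>\<^sup>+ t \<in> {u..v}. f t \<partial>lborel) / ennreal (v - u)))"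

lemma countable_rat_intervals: "countable {(u::real, v). u \<in> \<rat> \<and> v \<in> \<rat> \<and> u < v}"
  by (rule countable_subset[of _ "\<rat> \<times> \<rat>"]) (auto simp: countable_rat)

lemma measurable_hl_maximal [measurable]:
  fixes F :: "'a \<Rightarrow> real \<Rightarrow> ennreal"
  assumes [measurable]: "case_prod F \<in> borel_measurable (M \<Otimes>\<^sub>M borel)" "h \<in> borel_measurable M"
  shows "(\<lambda>x. hl_maximal (F x) (h x)) \<in> borel_measurable M"
proof -
  have [measurable]: "case_prod F \<in> borel_measurable (M \<Otimes>\<^sub>M lborel)"
    by simp
  show ?thesis
    unfolding hl_maximal_def
    by (intro borel_measurable_SUP countable_rat_intervals) auto
qed

text \<open>Intervals on which \<open>f\<close> has average above \<open>s\<close> have bounded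
  length when \<open>f\<close> is integrable, so Vitali selects disjoint ones whose fivefold
  enlargements cover the superlevel set. Disjointness bounds their total length by the integral of
  \<open>f\<close> divided by \<open>s\<close>.\<close>

lemma hl_maximal_weak:
  fixes f :: "real \<Rightarrow> ennreal"
  assumes [measurable]: "f \<in> borel_measurable borel" and s: "0 < s"
  shows "ennreal s * emeasure lborel {x. ennreal s < hl_maximal f x} \<le> 5 * (\<integral>\<^sup>+ t. f t \<partial>lborel)"
proof (cases "\<integral>\<^sup>+ t. f t \<partial>lborel")
  case top
  then show ?thesis by (simp add: ennreal_mult_top)
next
  case (real I)
  define A where "A = (\<lambda>(u::real, v::real). {u..v})"
  define c where "c = (\<lambda>(u::real, v::real). (u + v) / 2)"
  define r where "r = (\<lambda>(u::real, v::real). (v - u) / 2)"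
  define K where "K = {(u, v). u \<in> \<rat> \<and> v \<in> \<rat> \<and> u < v \<and> ennreal (s * (v - u)) < (\<integral>\<^sup>+ t \<in> {u..v}. f t \<partial>lborel)}"
  have cball: "cball (c j) (r j) = A j" for j
    by (cases j) (auto simp: c_def r_def A_def dist_real_def field_simps abs_le_iff)
  have [measurable]: "A j \<in> sets borel" for j
    by (cases j) (simp add: A_def)
  have [measurable]: "ball (c j) (5 * r j) \<in> sets borel" for j
    by simp
  have rK: "0 < r j \<and> r j \<le> I / s" if j: "j \<in> K" for j
  proof -
    obtain u v where uv: "j = (u, v)" by force
    have "ennreal (s * (v - u)) \<le> (\<integral>\<^sup>+ t \<in> {u..v}. f t \<partial>lborel)"
      using j by (auto simp: K_def uv)
    also have "\<dots> \<le> ennreal I"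
      unfolding real(2)[symmetric] by (intro nn_integral_mono) (auto simp: indicator_def)
    finally have "s * (v - u) \<le> I"
      using real by simp
    moreover have "u < v" using j by (auto simp: K_def uv)
    moreover have "v - u \<le> I / s"
      using calculation s by (simp add: pos_le_divide_eq mult.commute)
    moreover have "(v - u) / 2 \<le> v - u"
      using calculation by simp
    ultimately have "(v - u) / 2 \<le> I / s"
      using order_trans by blast
    then show ?thesis
      using \<open>u < v\<close> by (simp add: r_def uv)
  qed
  obtain C where C: "countable C" "C \<subseteq> K"
     "pairwise (\<lambda>i j. disjnt (cball (c i) (r i)) (cball (c j) (r j))) C"
     "\<And>i. i \<in> K \<Longrightarrow> \<exists>j. j \<in> C \<and> \<not> disjnt (cball (c i) (r i)) (cball (c j) (r j)) \<and>
                        cball (c i) (r i) \<subseteq> ball (c j) (5 * r j)"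
    using Vitali_covering_lemma_cballs_balls[of K r "I / s" c] rK by blast
  have sub: "\<exists>j\<in>C. x \<in> ball (c j) (5 * r j)" if x: "ennreal s < hl_maximal f x" for x
  proof -
    obtain u v where uv: "u \<in> \<rat>" "v \<in> \<rat>" "u < v"
      and *: "ennreal s < indicator {u..v} x * ((\<integral>\<^sup>+ t \<in> {u..v}. f t \<partial>lborel) / ennreal (v - u))"
      using x unfolding hl_maximal_def less_SUP_iff by auto
    have x: "x \<in> {u..v}"
    proof (rule ccontr)
      assume "x \<notin> {u..v}"
      then have "indicator {u..v} x = (0 :: ennreal)" by (rule indicator_simps)
      then show False using * by simp
    qed
    with * have "ennreal s < (\<integral>\<^sup>+ t \<in> {u..v}. f t \<partial>lborel) / ennreal (v - u)" by simp
    then have "ennreal s * ennreal (v - u) < (\<integral>\<^sup>+ t \<in> {u..v}. f t \<partial>lborel)"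
    proof (rule contrapos_pp)
      assume "\<not> ennreal s * ennreal (v - u) < (\<integral>\<^sup>+ t \<in> {u..v}. f t \<partial>lborel)"
      then have "(\<integral>\<^sup>+ t \<in> {u..v}. f t \<partial>lborel) / ennreal (v - u) \<le> ennreal s * ennreal (v - u) / ennreal (v - u)"
        by (intro divide_right_mono_ennreal) (simp only: not_less)
      also have "\<dots> = ennreal s"
        using uv by (simp add: mult_divide_eq_ennreal)
      finally show "\<not> ennreal s < (\<integral>\<^sup>+ t \<in> {u..v}. f t \<partial>lborel) / ennreal (v - u)"
        by (simp only: not_less)
    qed
    with uv s have "(u, v) \<in> K" by (simp add: K_def ennreal_mult)
    then obtain j where "j \<in> C" "cball (c (u, v)) (r (u, v)) \<subseteq> ball (c j) (5 * r j)"
      using C(4) by blast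
    moreover have "x \<in> A (u, v)" using x by (simp add: A_def)
    ultimately show ?thesis
      unfolding cball by blast
  qed
  have "ennreal s * emeasure lborel {x. ennreal s < hl_maximal f x}
    = (\<integral>\<^sup>+ x. ennreal s * indicator {x. ennreal s < hl_maximal f x} x \<partial>lborel)"
    by (subst nn_integral_cmult_indicator) auto
  \<comment> \<open>The sum over the countable, possibly infinite family is an integral over
    \<open>count_space C\<close>, which can be exchanged with the one over the line.\<close>
  also have "\<dots> \<le> (\<integral>\<^sup>+ x. \<integral>\<^sup>+ j. ennreal s * indicator (ball (c j) (5 * r j)) x \<partial>count_space C \<partial>lborel)"
  proof (intro nn_integral_mono)
    fix x
    show "ennreal s * indicator {x. ennreal s < hl_maximal f x} x
      \<le> (\<integral>\<^sup>+ j. ennreal s * indicator (ball (c j) (5 * r j)) x \<partial>count_space C)"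
    proof (cases "ennreal s < hl_maximal f x")
      case True
      then obtain j where j: "j \<in> C" "x \<in> ball (c j) (5 * r j)" using sub by blast
      show ?thesis
        using nn_integral_ge_point[OF j(1), of "\<lambda>j. ennreal s * indicator (ball (c j) (5 * r j)) x"] j True
        by simp
    qed simp
  qed
  also have "\<dots> = (\<integral>\<^sup>+ j. \<integral>\<^sup>+ x. ennreal s * indicator (ball (c j) (5 * r j)) x \<partial>lborel \<partial>count_space C)"
    by (rule nn_integral_count_space_nn_integral[OF C(1)]) measurable
  also have "\<dots> \<le> (\<integral>\<^sup>+ j. 5 * emeasure (density lborel f) (A j) \<partial>count_space C)"
  proof (intro nn_integral_mono)
    fix j assume "j \<in> space (count_space C)"
    then have jK: "j \<in> K" using C by auto
    obtain u v where uv: "j = (u, v)" by force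
    have "u < v" using jK by (auto simp: K_def uv)
    have "(\<integral>\<^sup>+ x. ennreal s * indicator (ball (c j) (5 * r j)) x \<partial>lborel) = ennreal s * ennreal (10 * r j)"
      using rK[OF jK] by (simp add: nn_integral_cmult_indicator ball_eq_greaterThanLessThan)
    also have "\<dots> = 5 * ennreal (s * (v - u))"
      using s \<open>u < v\<close> by (simp add: r_def uv flip: ennreal_mult ennreal_numeral)
    also have "\<dots> \<le> 5 * (\<integral>\<^sup>+ t \<in> {u..v}. f t \<partial>lborel)"
      using jK by (intro mult_left_mono) (auto simp: K_def uv)
    also have "\<dots> = 5 * emeasure (density lborel f) (A j)"
      by (simp add: A_def uv emeasure_density)
    finally show "(\<integral>\<^sup>+ x. ennreal s * indicator (ball (c j) (5 * r j)) x \<partial>lborel)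
       \<le> 5 * emeasure (density lborel f) (A j)" .
  qed
  also have "\<dots> = 5 * (\<integral>\<^sup>+ j. emeasure (density lborel f) (A j) \<partial>count_space C)"
    by (simp add: nn_integral_cmult)
  \<comment> \<open>As values of the measure with density \<open>f\<close>, the integrals over the
    disjoint intervals add up by countable additivity.\<close>
  also have "(\<integral>\<^sup>+ j. emeasure (density lborel f) (A j) \<partial>count_space C) = emeasure (density lborel f) (\<Union>(A ` C))"
    using C(1,3) by (intro emeasure_UN_countable[symmetric])
      (auto simp: cball disjoint_family_on_def pairwise_def disjnt_def)
  also have "\<dots> \<le> emeasure (density lborel f) (space (density lborel f))"
    by (rule emeasure_space)
  also have "\<dots> = (\<integral>\<^sup>+ t. f t \<partial>lborel)"
    by (simp add: emeasure_density)
  finally show ?thesis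
    by (simp add: mult_left_mono)
qed

text \<open>The part of \<open>f\<close> that does not exceed \<open>s\<close> has averages at most
  \<open>s\<close>.\<close>

lemma hl_maximal_split:
  fixes f :: "real \<Rightarrow> ennreal"
  assumes [measurable]: "f \<in> borel_measurable borel" and s: "0 < s"
  shows "hl_maximal f x \<le> hl_maximal (\<lambda>t. f t * indicator {t. ennreal s < f t} t) x + ennreal s"
  unfolding hl_maximal_def[of f]
proof (rule SUP_least, clarify)
  fix u v :: real assume uv: "u \<in> \<rat>" "v \<in> \<rat>" "u < v"
  let ?h = "\<lambda>t. f t * indicator {t. ennreal s < f t} t"
  have "(\<integral>\<^sup>+ t \<in> {u..v}. f t \<partial>lborel) \<le> (\<integral>\<^sup>+ t. ?h t * indicator {u..v} t + ennreal s * indicator {u..v} t \<partial>lborel)"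
    by (intro nn_integral_mono) (auto simp: indicator_def)
  also have "\<dots> = (\<integral>\<^sup>+ t \<in> {u..v}. ?h t \<partial>lborel) + ennreal s * ennreal (v - u)"
    using uv by (subst nn_integral_add) (auto simp: nn_integral_cmult_indicator)
  finally have "(\<integral>\<^sup>+ t \<in> {u..v}. f t \<partial>lborel) / ennreal (v - u)
      \<le> ((\<integral>\<^sup>+ t \<in> {u..v}. ?h t \<partial>lborel) + ennreal s * ennreal (v - u)) / ennreal (v - u)"
    by (rule divide_right_mono_ennreal)
  also have "\<dots> = (\<integral>\<^sup>+ t \<in> {u..v}. ?h t \<partial>lborel) / ennreal (v - u) + ennreal s"
    using uv s by (simp add: divide_ennreal_def ring_distribs mult.assoc) (simp flip: divide_ennreal_def add: ennreal_divide_self)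
  finally have *: "(\<integral>\<^sup>+ t \<in> {u..v}. f t \<partial>lborel) / ennreal (v - u)
      \<le> (\<integral>\<^sup>+ t \<in> {u..v}. ?h t \<partial>lborel) / ennreal (v - u) + ennreal s" .
  have "indicator {u..v} x * ((\<integral>\<^sup>+ t \<in> {u..v}. f t \<partial>lborel) / ennreal (v - u))
     \<le> indicator {u..v} x * ((\<integral>\<^sup>+ t \<in> {u..v}. ?h t \<partial>lborel) / ennreal (v - u)) + ennreal s"
    using * by (simp add: indicator_def)
  also have "indicator {u..v} x * ((\<integral>\<^sup>+ t \<in> {u..v}. ?h t \<partial>lborel) / ennreal (v - u)) \<le> hl_maximal ?h x"
    unfolding hl_maximal_def using uv by (intro SUP_upper2[of "(u, v)"]) auto
  finally show "indicator {u..v} x * ((\<integral>\<^sup>+ t \<in> {u..v}. f t \<partial>lborel) / ennreal (v - u)) \<le> hl_maximal ?h x + ennreal s"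
    by (simp add: add_right_mono)
qed

lemma hl_maximal_strong:
  fixes f :: "real \<Rightarrow> ennreal" and q :: real
  assumes f [measurable]: "f \<in> borel_measurable borel" and q: "1 < q"
  shows "(\<integral>\<^sup>+ x. epowr (hl_maximal f x) q \<partial>lborel)
    \<le> ennreal (10 * q * 2 powr (q - 1) / (q - 1)) * (\<integral>\<^sup>+ x. epowr (f x) q \<partial>lborel)"
proof (rule weak_type_interpolation)
  fix s :: real assume s: "0 < s"
  \<comment> \<open>Cutting at \<open>s / 2\<close> leaves level \<open>s / 2\<close> for the
    maximal function of the upper part. Returning to level \<open>s\<close> costs a factor 2, which
    with the 5 of the weak estimate gives 10.\<close>
  let ?h = "\<lambda>t. f t * indicator {t. ennreal (s / 2) < f t} t"
  have half: "ennreal s = ennreal (s / 2) + ennreal (s / 2)"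
    using s by (simp flip: ennreal_plus)
  have "{x. ennreal s < hl_maximal f x} \<subseteq> {x. ennreal (s / 2) < hl_maximal ?h x}"
  proof clarify
    fix x assume "ennreal s < hl_maximal f x"
    also have "\<dots> \<le> hl_maximal ?h x + ennreal (s / 2)"
      using s by (intro hl_maximal_split) auto
    finally have "ennreal (s / 2) + ennreal (s / 2) < hl_maximal ?h x + ennreal (s / 2)"
      using half by simp
    then show "ennreal (s / 2) < hl_maximal ?h x"
      by (meson add_right_mono not_le)
  qed
  then have "ennreal s * emeasure lborel {x. ennreal s < hl_maximal f x}
      \<le> ennreal s * emeasure lborel {x. ennreal (s / 2) < hl_maximal ?h x}"
    by (intro mult_left_mono emeasure_mono) auto
  also have "\<dots> = 2 * (ennreal (s / 2) * emeasure lborel {x. ennreal (s / 2) < hl_maximal ?h x})"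
    using s by (simp flip: mult.assoc ennreal_mult ennreal_numeral)
  also have "\<dots> \<le> 2 * (5 * (\<integral>\<^sup>+ t. ?h t \<partial>lborel))"
    using s by (intro mult_left_mono hl_maximal_weak) auto
  also have "(\<integral>\<^sup>+ t. ?h t \<partial>lborel) = (\<integral>\<^sup>+ x. f x * indicator {x. ennreal s < 2 * f x} x \<partial>lborel)"
  proof (intro nn_integral_cong)
    fix t
    have "ennreal (s / 2) < f t \<longleftrightarrow> ennreal s < 2 * f t"
      using s by (cases "f t")
        (auto simp: ennreal_less_iff ennreal_mult_top simp flip: ennreal_mult ennreal_numeral)
    then show "?h t = f t * indicator {x. ennreal s < 2 * f x} t"
      by (simp add: indicator_def)
  qed
  also have "2 * (5 * (\<integral>\<^sup>+ x. f x * indicator {x. ennreal s < 2 * f x} x \<partial>lborel))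
     = ennreal 10 * (\<integral>\<^sup>+ x. f x * indicator {x. ennreal s < 2 * f x} x \<partial>lborel)"
    by (simp flip: mult.assoc)
  finally show "ennreal s * emeasure lborel {x \<in> space lborel. ennreal s < hl_maximal f x}
       \<le> ennreal 10 * (\<integral>\<^sup>+ x. f x * indicator {x. ennreal s < 2 * f x} x \<partial>lborel)"
    by simp
qed (use q in \<open>auto simp: sigma_finite_lborel\<close>)

lemma hl_maximal_ge:
  fixes u v x :: real
  assumes uv: "u < v" and x: "x \<in> {u..v}"
  shows "(\<integral>\<^sup>+ t \<in> {u..v}. f t \<partial>lborel) \<le> ennreal (2 * (v - u)) * hl_maximal f x"
proof -
  \<comment> \<open>Each end moves outwards by less than half the length, so the rational interval
    is at most twice as long.\<close>
  obtain u' where u': "u' \<in> \<rat>" "u - (v - u) / 2 < u'" "u' < u"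
    using Rats_dense_in_real[of "u - (v - u) / 2" u] uv by auto
  obtain v' where v': "v' \<in> \<rat>" "v < v'" "v' < v + (v - u) / 2"
    using Rats_dense_in_real[of v "v + (v - u) / 2"] uv by auto
  have uv': "u' < v'" using u' v' uv by simp
  have "indicator {u'..v'} x * ((\<integral>\<^sup>+ t \<in> {u'..v'}. f t \<partial>lborel) / ennreal (v' - u')) \<le> hl_maximal f x"
    unfolding hl_maximal_def using u' v' uv' by (intro SUP_upper2[of "(u', v')"]) auto
  moreover have "indicator {u'..v'} x = (1 :: ennreal)"
    using x u' v' by (auto simp: indicator_def)
  ultimately have *: "(\<integral>\<^sup>+ t \<in> {u'..v'}. f t \<partial>lborel) / ennreal (v' - u') \<le> hl_maximal f x"
    by simp
  have "(\<integral>\<^sup>+ t \<in> {u..v}. f t \<partial>lborel) \<le> (\<integral>\<^sup>+ t \<in> {u'..v'}. f t \<partial>lborel)"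
    using u' v' by (intro nn_integral_mono) (auto simp: indicator_def)
  also have "\<dots> = ennreal (v' - u') * ((\<integral>\<^sup>+ t \<in> {u'..v'}. f t \<partial>lborel) / ennreal (v' - u'))"
    using uv' mult_divide_eq_ennreal[of "ennreal (v' - u')" "\<integral>\<^sup>+ t \<in> {u'..v'}. f t \<partial>lborel"]
    by (simp add: ennreal_times_divide mult.commute)
  also have "\<dots> \<le> ennreal (2 * (v - u)) * hl_maximal f x"
  proof (intro mult_mono ennreal_leI)
    show "v' - u' \<le> 2 * (v - u)" using u' v' by (simp add: field_simps)
  qed (use * in auto)
  finally show ?thesis .
qed

text \<open>Not the supremum over axis-parallel boxes, but the one-dimensional operator in the first
  coordinate followed by the one in the second. It dominates box averages up to a constant, and its
  norm estimate reduces to one dimension by Fubini.\<close>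

definition strong_maximal :: "(plane \<Rightarrow> ennreal) \<Rightarrow> plane \<Rightarrow> ennreal" where
  "strong_maximal F z = hl_maximal (\<lambda>t. hl_maximal (\<lambda>s. F (s, t)) (fst z)) (snd z)"

lemma measurable_strong_maximal [measurable]:
  assumes [measurable]: "F \<in> borel_measurable borel"
  shows "strong_maximal F \<in> borel_measurable borel"
proof -
  have [measurable]: "F \<in> borel_measurable (borel \<Otimes>\<^sub>M borel)"
    by (simp add: borel_prod)
  show ?thesis
    unfolding strong_maximal_def borel_prod[symmetric] by measurable
qed

lemma nn_integral_plane:
  fixes F :: "plane \<Rightarrow> ennreal"
  assumes "F \<in> borel_measurable borel"
  shows "(\<integral>\<^sup>+ z. F z \<partial>lborel) = (\<integral>\<^sup>+ x. \<integral>\<^sup>+ y. F (x, y) \<partial>lborel \<partial>lborel)"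
    and "(\<integral>\<^sup>+ z. F z \<partial>lborel) = (\<integral>\<^sup>+ y. \<integral>\<^sup>+ x. F (x, y) \<partial>lborel \<partial>lborel)"
proof -
  have F: "F \<in> borel_measurable (lborel \<Otimes>\<^sub>M lborel)"
    using assms by (simp add: lborel_prod)
  show "(\<integral>\<^sup>+ z. F z \<partial>lborel) = (\<integral>\<^sup>+ x. \<integral>\<^sup>+ y. F (x, y) \<partial>lborel \<partial>lborel)"
    using lborel.nn_integral_fst[OF F] by (simp add: lborel_prod)
  show "(\<integral>\<^sup>+ z. F z \<partial>lborel) = (\<integral>\<^sup>+ y. \<integral>\<^sup>+ x. F (x, y) \<partial>lborel \<partial>lborel)"
    using lborel_pair.nn_integral_snd[OF F] by (simp add: lborel_prod)
qed

lemma strong_maximal_strong: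
  fixes F :: "plane \<Rightarrow> ennreal" and q :: real
  assumes F: "F \<in> borel_measurable borel" and q: "1 < q"
  defines "C \<equiv> ennreal (10 * q * 2 powr (q - 1) / (q - 1))"
  shows "(\<integral>\<^sup>+ z. epowr (strong_maximal F z) q \<partial>lborel) \<le> C * C * (\<integral>\<^sup>+ z. epowr (F z) q \<partial>lborel)"
proof -
  note [measurable] = F
  have [measurable]: "F \<in> borel_measurable (borel \<Otimes>\<^sub>M borel)"
    using F by (simp add: borel_prod)
  define G where "G z = hl_maximal (\<lambda>s. F (s, snd z)) (fst z)" for z :: plane
  have G: "G \<in> borel_measurable (borel \<Otimes>\<^sub>M borel)"
    unfolding G_def by measurable
  have [measurable]: "G \<in> borel_measurable borel"
    using G by (simp add: borel_prod)
  note [measurable] = G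
  have "(\<integral>\<^sup>+ z. epowr (strong_maximal F z) q \<partial>lborel)
      = (\<integral>\<^sup>+ x. \<integral>\<^sup>+ y. epowr (hl_maximal (\<lambda>t. G (x, t)) y) q \<partial>lborel \<partial>lborel)"
    by (subst nn_integral_plane(1), measurable) (simp add: strong_maximal_def G_def)
  also have "\<dots> \<le> (\<integral>\<^sup>+ x. C * (\<integral>\<^sup>+ y. epowr (G (x, y)) q \<partial>lborel) \<partial>lborel)"
    unfolding C_def by (rule nn_integral_mono, rule hl_maximal_strong) (use q in auto)
  also have "\<dots> = C * (\<integral>\<^sup>+ x. \<integral>\<^sup>+ y. epowr (G (x, y)) q \<partial>lborel \<partial>lborel)"
    by (rule nn_integral_cmult) measurable
  also have "(\<integral>\<^sup>+ x. \<integral>\<^sup>+ y. epowr (G (x, y)) q \<partial>lborel \<partial>lborel) = (\<integral>\<^sup>+ z. epowr (G z) q \<partial>lborel)"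
    by (rule nn_integral_plane(1)[symmetric]) measurable
  \<comment> \<open>In this order the inner integral runs along the coordinate in which
    \<open>G\<close> is a maximal function.\<close>
  also have "\<dots> = (\<integral>\<^sup>+ y. \<integral>\<^sup>+ x. epowr (hl_maximal (\<lambda>s. F (s, y)) x) q \<partial>lborel \<partial>lborel)"
    by (subst nn_integral_plane(2), measurable) (simp add: G_def)
  also have "\<dots> \<le> (\<integral>\<^sup>+ y. C * (\<integral>\<^sup>+ x. epowr (F (x, y)) q \<partial>lborel) \<partial>lborel)"
    unfolding C_def by (rule nn_integral_mono, rule hl_maximal_strong) (use q in auto)
  also have "\<dots> = C * (\<integral>\<^sup>+ y. \<integral>\<^sup>+ x. epowr (F (x, y)) q \<partial>lborel \<partial>lborel)"
    by (rule nn_integral_cmult) measurable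
  also have "(\<integral>\<^sup>+ y. \<integral>\<^sup>+ x. epowr (F (x, y)) q \<partial>lborel \<partial>lborel) = (\<integral>\<^sup>+ z. epowr (F z) q \<partial>lborel)"
    by (rule nn_integral_plane(2)[symmetric]) measurable
  finally show ?thesis
    by (simp add: mult_left_mono mult.assoc)
qed

text \<open>\<open>hl_maximal_ge\<close> is used on every horizontal line at the abscissa
  \<open>fst z\<close>, then once vertically at the ordinate \<open>snd z\<close>; the two factors 2
  make the 4.\<close>

lemma box_le_strong_maximal:
  fixes F :: "plane \<Rightarrow> ennreal"
  assumes F: "F \<in> borel_measurable borel" and "u < v" "u' < v'" and z: "fst z \<in> {u..v}" "snd z \<in> {u'..v'}"
  shows "(\<integral>\<^sup>+ z \<in> {u..v} \<times> {u'..v'}. F z \<partial>lborel)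
    \<le> ennreal (4 * (v - u) * (v' - u')) * strong_maximal F z"
proof -
  note [measurable] = F
  have [measurable]: "F \<in> borel_measurable (borel \<Otimes>\<^sub>M borel)"
    using F by (simp add: borel_prod)
  have [measurable]: "{u..v} \<times> {u'..v'} \<in> sets borel"
    by (intro borel_closed closed_Times) auto
  let ?H = "\<lambda>t. hl_maximal (\<lambda>s. F (s, t)) (fst z)"
  have "(\<integral>\<^sup>+ z \<in> {u..v} \<times> {u'..v'}. F z \<partial>lborel)
     = (\<integral>\<^sup>+ t. (\<integral>\<^sup>+ s \<in> {u..v}. F (s, t) \<partial>lborel) * indicator {u'..v'} t \<partial>lborel)"
    by (subst nn_integral_plane(2), measurable)
      (auto simp: indicator_times nn_integral_multc simp flip: mult.assoc)
  also have "\<dots> \<le> (\<integral>\<^sup>+ t. ennreal (2 * (v - u)) * (?H t * indicator {u'..v'} t) \<partial>lborel)"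
  proof (rule nn_integral_mono)
    fix t
    have "(\<integral>\<^sup>+ s \<in> {u..v}. F (s, t) \<partial>lborel) \<le> ennreal (2 * (v - u)) * ?H t"
      using assms by (intro hl_maximal_ge) auto
    then show "(\<integral>\<^sup>+ s \<in> {u..v}. F (s, t) \<partial>lborel) * indicator {u'..v'} t
       \<le> ennreal (2 * (v - u)) * (?H t * indicator {u'..v'} t)"
      by (subst mult.assoc[symmetric]) (rule mult_right_mono, simp_all)
  qed
  also have "\<dots> = ennreal (2 * (v - u)) * (\<integral>\<^sup>+ t \<in> {u'..v'}. ?H t \<partial>lborel)"
    by (rule nn_integral_cmult) measurable
  also have "\<dots> \<le> ennreal (2 * (v - u)) * (ennreal (2 * (v' - u')) * strong_maximal F z)"
    unfolding strong_maximal_def using assms by (intro mult_left_mono hl_maximal_ge) auto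
  also have "\<dots> = ennreal (4 * (v - u) * (v' - u')) * strong_maximal F z"
  proof -
    have "4 * (v - u) * (v' - u') = 2 * (v - u) * (2 * (v' - u'))"
      by (simp add: algebra_simps)
    then have "ennreal (4 * (v - u) * (v' - u')) = ennreal (2 * (v - u)) * ennreal (2 * (v' - u'))"
      using assms by (simp only:) (rule ennreal_mult, auto)
    then show ?thesis
      by (simp only: mult.assoc)
  qed
  finally show ?thesis .
qed

section \<open>Rectangles\<close>

text \<open>The two expressions are the coordinates of \<open>p - c\<close> in the orthonormal frame
  of the sides, so membership becomes four linear inequalities.\<close>

lemma mem_rectangle_iff:
  "p \<in> rectangle c w l s \<longleftrightarrow>
    (fst p - fst c) * cos w + (snd p - snd c) * sin w \<in> {0..l} \<and>
    (snd p - snd c) * cos w - (fst p - fst c) * sin w \<in> {0..s}"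
  (is "_ \<longleftrightarrow> ?U \<in> _ \<and> ?V \<in> _")
proof
  assume "p \<in> rectangle c w l s"
  then obtain u v where uv: "p = c + u *\<^sub>R (cos w, sin w) + v *\<^sub>R (- sin w, cos w)"
    "0 \<le> u" "u \<le> l" "0 \<le> v" "v \<le> s"
    by (auto simp: rectangle_def)
  have "fst p - fst c = u * cos w - v * sin w" "snd p - snd c = u * sin w + v * cos w"
    by (simp_all add: uv)
  then have "?U = u * ((cos w)\<^sup>2 + (sin w)\<^sup>2)" "?V = v * ((cos w)\<^sup>2 + (sin w)\<^sup>2)"
    by algebra+
  with uv show "?U \<in> {0..l} \<and> ?V \<in> {0..s}"
    by simp
next
  assume *: "?U \<in> {0..l} \<and> ?V \<in> {0..s}"
  have "?U * cos w - ?V * sin w = (fst p - fst c) * ((cos w)\<^sup>2 + (sin w)\<^sup>2)"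
    "?U * sin w + ?V * cos w = (snd p - snd c) * ((cos w)\<^sup>2 + (sin w)\<^sup>2)"
    by algebra+
  then have "p = c + ?U *\<^sub>R (cos w, sin w) + ?V *\<^sub>R (- sin w, cos w)"
    by (simp add: prod_eq_iff)
  with * show "p \<in> rectangle c w l s"
    unfolding rectangle_def by (intro CollectI exI[of _ ?U] exI[of _ ?V]) auto
qed

lemma closed_rectangle: "closed (rectangle c w l s)"
proof -
  have "rectangle c w l s =
    {p. 0 \<le> (fst p - fst c) * cos w + (snd p - snd c) * sin w} \<inter>
    {p. (fst p - fst c) * cos w + (snd p - snd c) * sin w \<le> l} \<inter>
    {p. 0 \<le> (snd p - snd c) * cos w - (fst p - fst c) * sin w} \<inter>
    {p. (snd p - snd c) * cos w - (fst p - fst c) * sin w \<le> s}"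
    by (auto simp: mem_rectangle_iff)
  also have "closed \<dots>"
    by (intro closed_Int closed_Collect_le continuous_intros)
  finally show ?thesis .
qed

lemma sets_rectangle [measurable]: "rectangle c w l s \<in> sets borel"
  by (intro borel_closed closed_rectangle)

text \<open>A rotation is a composition of two shears and a scaling, each of which acts on one coordinate only.\<close>

lemma nn_integral_rotate:
  fixes F :: "plane \<Rightarrow> ennreal"
  assumes F: "F \<in> borel_measurable borel" and w: "cos w \<noteq> 0"
  shows "(\<integral>\<^sup>+ p. F p \<partial>lborel) =
    (\<integral>\<^sup>+ v. \<integral>\<^sup>+ u. F (u * cos w - v * sin w, u * sin w + v * cos w) \<partial>lborel \<partial>lborel)"
proof -
  note [measurable] = F
  have [measurable]: "F \<in> borel_measurable (borel \<Otimes>\<^sub>M borel)"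
    using F by (simp add: borel_prod)
  have "(\<integral>\<^sup>+ p. F p \<partial>lborel) = (\<integral>\<^sup>+ x. \<integral>\<^sup>+ y. F (x, y) \<partial>lborel \<partial>lborel)"
    by (rule nn_integral_plane(1)) fact
  \<comment> \<open>Substitution \<open>y = x * tan w + v / cos w\<close> at fixed \<open>x\<close>;
    later \<open>x = u * cos w - v * sin w\<close> at fixed \<open>v\<close>. The Jacobians
    \<open>1 / cos w\<close> and \<open>cos w\<close> cancel.\<close>
  also have "\<dots> = (\<integral>\<^sup>+ x. ennreal \<bar>1 / cos w\<bar> * (\<integral>\<^sup>+ v. F (x, x * sin w / cos w + 1 / cos w * v) \<partial>lborel) \<partial>lborel)"
    using w by (intro nn_integral_cong nn_integral_real_affine) auto
  also have "\<dots> = ennreal \<bar>1 / cos w\<bar> * (\<integral>\<^sup>+ x. \<integral>\<^sup>+ v. F (x, x * sin w / cos w + 1 / cos w * v) \<partial>lborel \<partial>lborel)"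
    by (rule nn_integral_cmult) measurable
  also have "(\<integral>\<^sup>+ x. \<integral>\<^sup>+ v. F (x, x * sin w / cos w + 1 / cos w * v) \<partial>lborel \<partial>lborel)
     = (\<integral>\<^sup>+ v. \<integral>\<^sup>+ x. F (x, x * sin w / cos w + 1 / cos w * v) \<partial>lborel \<partial>lborel)"
    by (rule lborel_pair.Fubini'[symmetric]) measurable
  also have "\<dots> = (\<integral>\<^sup>+ v. ennreal \<bar>cos w\<bar> * (\<integral>\<^sup>+ u. F (- v * sin w + cos w * u,
      (- v * sin w + cos w * u) * sin w / cos w + 1 / cos w * v) \<partial>lborel) \<partial>lborel)"
    using w by (intro nn_integral_cong nn_integral_real_affine) auto
  also have "\<dots> = ennreal \<bar>cos w\<bar> * (\<integral>\<^sup>+ v. \<integral>\<^sup>+ u. F (- v * sin w + cos w * u,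
      (- v * sin w + cos w * u) * sin w / cos w + 1 / cos w * v) \<partial>lborel \<partial>lborel)"
    by (rule nn_integral_cmult) measurable
  also have "ennreal \<bar>1 / cos w\<bar> * (ennreal \<bar>cos w\<bar> * (\<integral>\<^sup>+ v. \<integral>\<^sup>+ u. F (- v * sin w + cos w * u,
      (- v * sin w + cos w * u) * sin w / cos w + 1 / cos w * v) \<partial>lborel \<partial>lborel))
    = (\<integral>\<^sup>+ v. \<integral>\<^sup>+ u. F (- v * sin w + cos w * u,
      (- v * sin w + cos w * u) * sin w / cos w + 1 / cos w * v) \<partial>lborel \<partial>lborel)"
    using w by (simp flip: mult.assoc ennreal_mult abs_mult)
  also have "\<dots> = (\<integral>\<^sup>+ v. \<integral>\<^sup>+ u. F (u * cos w - v * sin w, u * sin w + v * cos w) \<partial>lborel \<partial>lborel)"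
  proof (intro nn_integral_cong)
    fix u v
    have "v * (sin w)\<^sup>2 + v * (cos w)\<^sup>2 = v"
      by (simp flip: distrib_left)
    then have "(- v * sin w + cos w * u) * sin w / cos w + 1 / cos w * v = u * sin w + v * cos w"
      using w by (simp add: field_simps power2_eq_square)
    then show "F (- v * sin w + cos w * u, (- v * sin w + cos w * u) * sin w / cos w + 1 / cos w * v)
       = F (u * cos w - v * sin w, u * sin w + v * cos w)"
      by (simp add: mult.commute)
  qed
  finally show ?thesis .
qed

lemma emeasure_rectangle:
  assumes w: "cos w \<noteq> 0" and "0 \<le> l" "0 \<le> s"
  shows "emeasure lborel (rectangle c w l s) = ennreal (l * s)"
proof -
  let ?u = "fst c * cos w + snd c * sin w" and ?v = "snd c * cos w - fst c * sin w"
  have "emeasure lborel (rectangle c w l s) = (\<integral>\<^sup>+ p. indicator (rectangle c w l s) p \<partial>lborel)"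
    by simp
  also have "\<dots> = (\<integral>\<^sup>+ v. \<integral>\<^sup>+ u. indicator (rectangle c w l s)
       (u * cos w - v * sin w, u * sin w + v * cos w) \<partial>lborel \<partial>lborel)"
    by (rule nn_integral_rotate) (use w in auto)
  also have "\<dots> = (\<integral>\<^sup>+ v. \<integral>\<^sup>+ u. indicator {?v..?v + s} v * indicator {?u..?u + l} u \<partial>lborel \<partial>lborel)"
  proof (intro nn_integral_cong)
    fix u v
    have "u * (cos w)\<^sup>2 + u * (sin w)\<^sup>2 = u" "v * (cos w)\<^sup>2 + v * (sin w)\<^sup>2 = v"
      by (simp_all flip: distrib_left)
    then have "(u * cos w - v * sin w - fst c) * cos w + (u * sin w + v * cos w - snd c) * sin w = u - ?u"
      "(u * sin w + v * cos w - snd c) * cos w - (u * cos w - v * sin w - fst c) * sin w = v - ?v"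
      by (simp_all add: algebra_simps power2_eq_square)
    then have "(u * cos w - v * sin w, u * sin w + v * cos w) \<in> rectangle c w l s
       \<longleftrightarrow> v \<in> {?v..?v + s} \<and> u \<in> {?u..?u + l}"
      unfolding mem_rectangle_iff by auto
    then show "indicator (rectangle c w l s) (u * cos w - v * sin w, u * sin w + v * cos w)
      = indicator {?v..?v + s} v * (indicator {?u..?u + l} u :: ennreal)"
      by (simp only: indicator_def) auto
  qed
  also have "\<dots> = ennreal (l * s)"
    using assms by (simp add: nn_integral_cmult nn_integral_multc ennreal_mult mult.commute)
  finally show ?thesis .
qed

lemma homothet_rectangle:
  assumes "0 < h"
  shows "(\<lambda>y. t + h *\<^sub>R y) ` rectangle c w l s = rectangle (t + h *\<^sub>R c) w (h * l) (h * s)"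
proof (intro set_eqI iffI)
  fix p assume "p \<in> (\<lambda>y. t + h *\<^sub>R y) ` rectangle c w l s"
  then obtain u v where "p = t + h *\<^sub>R (c + u *\<^sub>R (cos w, sin w) + v *\<^sub>R (- sin w, cos w))"
    "0 \<le> u" "u \<le> l" "0 \<le> v" "v \<le> s"
    unfolding rectangle_def by blast
  then show "p \<in> rectangle (t + h *\<^sub>R c) w (h * l) (h * s)"
    unfolding rectangle_def using assms
    by (intro CollectI exI[of _ "h * u"] exI[of _ "h * v"]) (auto simp: algebra_simps)
next
  fix p assume "p \<in> rectangle (t + h *\<^sub>R c) w (h * l) (h * s)"
  then obtain u v where p: "p = t + h *\<^sub>R c + u *\<^sub>R (cos w, sin w) + v *\<^sub>R (- sin w, cos w)"
    and uv: "0 \<le> u" "u \<le> h * l" "0 \<le> v" "v \<le> h * s"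
    unfolding rectangle_def by blast
  have "p = t + h *\<^sub>R (c + (u / h) *\<^sub>R (cos w, sin w) + (v / h) *\<^sub>R (- sin w, cos w))"
    using assms by (simp add: p prod_eq_iff algebra_simps)
  moreover have "c + (u / h) *\<^sub>R (cos w, sin w) + (v / h) *\<^sub>R (- sin w, cos w) \<in> rectangle c w l s"
    unfolding rectangle_def using assms uv
    by (intro CollectI exI[of _ "u / h"] exI[of _ "v / h"]) (auto simp: field_simps)
  ultimately show "p \<in> (\<lambda>y. t + h *\<^sub>R y) ` rectangle c w l s"
    by blast
qed

text \<open>Homotheties preserve eccentricity and orientation, and the family already contains all
  positions and sizes, so it equals its set of homothets. Corner, long side and index then
  parametrize it.\<close>

lemma homothets_rect_family:
  assumes "0 < a" "0 < b"
  shows "homothets (rect_family a b) =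
    {rectangle c (pi / (4 * real n powr b)) l (l / real n powr a) | c l n. 1 \<le> n \<and> 0 < l}"
    (is "_ = ?R")
proof (intro set_eqI iffI)
  fix R assume "R \<in> homothets (rect_family a b)"
  then obtain t h c l s and n :: nat where "0 < h" "1 \<le> n" "0 < s" "s \<le> l" "1 / real n powr a = s / l"
    and R: "R = (\<lambda>y. t + h *\<^sub>R y) ` rectangle c (pi / (4 * real n powr b)) l s"
    unfolding homothets_def rect_family_def has_ecc_orient_def by auto
  moreover from this have "h * s = h * l / real n powr a"
    by (simp add: field_simps)
  ultimately have "R = rectangle (t + h *\<^sub>R c) (pi / (4 * real n powr b)) (h * l) (h * l / real n powr a)"
    "0 < h * l"
    by (simp_all add: homothet_rectangle)
  with \<open>1 \<le> n\<close> show "R \<in> ?R" by blast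
next
  fix R assume "R \<in> ?R"
  then obtain c l and n :: nat where "1 \<le> n" "0 < l"
    and R: "R = rectangle c (pi / (4 * real n powr b)) l (l / real n powr a)"
    by blast
  have n: "1 \<le> real n powr a" "1 \<le> real n powr b"
    using \<open>1 \<le> n\<close> assms by (auto intro: ge_one_powr_ge_zero)
  have "has_ecc_orient R (1 / real n powr a) (pi / (4 * real n powr b))"
    unfolding has_ecc_orient_def
  proof (intro conjI exI)
    have "pi / (4 * real n powr b) \<le> pi / 4"
      using n \<open>1 \<le> n\<close> pi_gt_zero by (intro divide_left_mono) auto
    also have "\<dots> < pi" using pi_gt_zero by simp
    finally show "pi / (4 * real n powr b) < pi" .
    show "R = rectangle c (pi / (4 * real n powr b)) l (l / real n powr a)" by (rule R)
    show "l / real n powr a \<le> l" 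
      using n \<open>1 \<le> n\<close> \<open>0 < l\<close> divide_left_mono[of 1 "real n powr a" l] by simp
  qed (use n \<open>0 < l\<close> \<open>1 \<le> n\<close> in auto)
  then have "R \<in> rect_family a b"
    unfolding rect_family_def using \<open>1 \<le> n\<close> by blast
  moreover have "R = (\<lambda>y. 0 + 1 *\<^sub>R y) ` R" by simp
  ultimately show "R \<in> homothets (rect_family a b)"
    unfolding homothets_def using zero_less_one by blast
qed

text \<open>The long side rises by at most \<open>l * w \<le> s\<close>, and the short side leans to
  the left by at most \<open>s\<close>.\<close>

lemma rectangle_subset_box:
  assumes "0 < s" "s \<le> l" "0 \<le> w" "w \<le> pi / 4 * (s / l)"
  shows "rectangle c w l s \<subseteq> {fst c - s..fst c + l} \<times> {snd c..snd c + 2 * s}"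
proof
  fix p assume "p \<in> rectangle c w l s"
  then obtain u v where p: "p = c + u *\<^sub>R (cos w, sin w) + v *\<^sub>R (- sin w, cos w)"
    and uv: "0 \<le> u" "u \<le> l" "0 \<le> v" "v \<le> s"
    unfolding rectangle_def by blast
  have "pi / 4 * (s / l) \<le> 1 * (s / l)"
    using pi_less_4 assms by (intro mult_right_mono) auto
  with assms have w: "w \<le> s / l" by simp
  also have "s / l \<le> 1" using assms by simp
  finally have "w \<le> 1" .
  then have "0 \<le> sin w" "0 \<le> cos w"
    using assms pi_gt3 by (auto intro!: sin_ge_zero cos_ge_zero)
  have "u * sin w \<le> l * (s / l)"
    using uv assms w \<open>0 \<le> sin w\<close> sin_x_le_x[of w] by (intro mult_mono) auto
  then have "u * sin w \<le> s" using assms by simp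
  moreover have "u * cos w \<le> l * 1" "v * sin w \<le> s * 1" "v * cos w \<le> s * 1"
    using uv assms \<open>0 \<le> sin w\<close> \<open>0 \<le> cos w\<close> by (intro mult_mono; auto)+
  moreover have "0 \<le> u * cos w" "0 \<le> u * sin w" "0 \<le> v * cos w" "0 \<le> v * sin w"
    using uv \<open>0 \<le> sin w\<close> \<open>0 \<le> cos w\<close> by auto
  ultimately show "p \<in> {fst c - s..fst c + l} \<times> {snd c..snd c + 2 * s}"
    by (auto simp: p mem_Times_iff)
qed

section \<open>The case \<open>a \<le> b\<close>\<close>

locale rectangle_exponents =
  fixes a b :: real
  assumes a: "0 < a" and b: "0 < b"
begin

definition angle :: "nat \<Rightarrow> real" where
  "angle n = pi / (4 * real n powr b)"

definition ecc :: "nat \<Rightarrow> real" where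
  "ecc n = 1 / real n powr a"

lemma angle_bounds:
  assumes "1 \<le> n"
  shows "0 < angle n" "angle n \<le> pi / 4" "0 < cos (angle n)"
proof -
  have n: "0 < real n powr b" "1 \<le> real n powr b"
    using assms b by (auto intro: ge_one_powr_ge_zero)
  then show "0 < angle n"
    by (simp add: angle_def)
  have "pi / (4 * real n powr b) \<le> pi / 4"
    using n pi_gt_zero by (intro divide_left_mono) auto
  then show "angle n \<le> pi / 4"
    by (simp add: angle_def)
  with \<open>0 < angle n\<close> show "0 < cos (angle n)"
    using pi_gt_zero by (intro cos_gt_zero) auto
qed

lemma ecc_bounds:
  assumes "1 \<le> n"
  shows "0 < ecc n" "ecc n \<le> 1"
  using assms a by (auto simp: ecc_def intro: ge_one_powr_ge_zero)

text \<open>Indexing by parameters makes the area explicit and exchanges \<open>lebesgue\<close> for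
  \<open>lborel\<close>, on which the Fubini arguments are stated.\<close>

lemma maximal_op_eq:
  "maximal_op (rect_family a b) f x =
    (SUP (c, l, n) \<in> {(c, l, n). 1 \<le> n \<and> 0 < l \<and> x \<in> rectangle c (angle n) l (l * ecc n)}.
      (\<integral>\<^sup>+ y \<in> rectangle c (angle n) l (l * ecc n). ennreal \<bar>f y\<bar> \<partial>lborel) / ennreal (l * (l * ecc n)))"
proof -
  let ?I = "{(c, l, n). 1 \<le> n \<and> 0 < l \<and> x \<in> rectangle c (angle n) l (l * ecc n)}"
  let ?R = "\<lambda>(c, l, n). rectangle c (angle n) l (l * ecc n)"
  have "{R \<in> homothets (rect_family a b). x \<in> R} = ?R ` ?I"
    unfolding homothets_rect_family[OF a b] by (auto simp: angle_def ecc_def image_iff)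
  then have "maximal_op (rect_family a b) f x =
    (SUP i \<in> ?I. (\<integral>\<^sup>+ y \<in> ?R i. ennreal \<bar>f y\<bar> \<partial>lebesgue) / emeasure lebesgue (?R i))"
    by (simp only: maximal_op_def image_image)
  also have "\<dots> = (SUP (c, l, n) \<in> ?I.
      (\<integral>\<^sup>+ y \<in> rectangle c (angle n) l (l * ecc n). ennreal \<bar>f y\<bar> \<partial>lborel) / ennreal (l * (l * ecc n)))"
  proof (rule SUP_cong)
    fix i assume "i \<in> ?I"
    then obtain c l n where i: "i = (c, l, n)" "1 \<le> n" "0 < l" by auto
    have "emeasure lborel (rectangle c (angle n) l (l * ecc n)) = ennreal (l * (l * ecc n))"
      using i angle_bounds[of n] ecc_bounds[of n] by (intro emeasure_rectangle) auto
    then show "(\<integral>\<^sup>+ y \<in> ?R i. ennreal \<bar>f y\<bar> \<partial>lebesgue) / emeasure lebesgue (?R i)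
      = (case i of (c, l, n) \<Rightarrow>
          (\<integral>\<^sup>+ y \<in> rectangle c (angle n) l (l * ecc n). ennreal \<bar>f y\<bar> \<partial>lborel) / ennreal (l * (l * ecc n)))"
      by (simp add: i nn_integral_completion)
  qed simp
  finally show ?thesis .
qed

lemma maximal_op_ge:
  assumes "1 \<le> n" "0 < l" "x \<in> rectangle c (angle n) l (l * ecc n)"
  shows "(\<integral>\<^sup>+ y \<in> rectangle c (angle n) l (l * ecc n). ennreal \<bar>f y\<bar> \<partial>lborel) / ennreal (l * (l * ecc n))
    \<le> maximal_op (rect_family a b) f x"
  unfolding maximal_op_eq using assms by (intro SUP_upper2[of "(c, l, n)"]) auto

lemma maximal_op_le_strong_maximal:
  assumes "a \<le> b" and F [measurable]: "F \<in> borel_measurable borel"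
    and eq: "AE y in lborel. ennreal \<bar>f y\<bar> = F y"
  shows "maximal_op (rect_family a b) f x \<le> ennreal 16 * strong_maximal F x"
  unfolding maximal_op_eq
proof (rule SUP_least, clarify)
  fix c and l :: real and n :: nat
  assume n: "1 \<le> n" and l: "0 < l" and x: "x \<in> rectangle c (angle n) l (l * ecc n)"
  define s where "s = l * ecc n"
  have s: "0 < s" "s \<le> l"
    using ecc_bounds[OF n] l by (auto simp: s_def)
  \<comment> \<open>The only use of \<open>a \<le> b\<close>: it bounds the angle by
    \<open>pi / 4\<close> times the eccentricity.\<close>
  have "real n powr a \<le> real n powr b"
    using n \<open>a \<le> b\<close> by (intro powr_mono) auto
  then have "pi / 4 * (1 / real n powr b) \<le> pi / 4 * (1 / real n powr a)"
    using n by (intro mult_left_mono divide_left_mono) auto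
  then have w: "angle n \<le> pi / 4 * (s / l)"
    using l by (simp add: angle_def s_def ecc_def)
  let ?B = "{fst c - s..fst c + l} \<times> {snd c..snd c + 2 * s}"
  have sub: "rectangle c (angle n) l s \<subseteq> ?B"
    using angle_bounds[OF n] w s by (intro rectangle_subset_box) auto
  have "(\<integral>\<^sup>+ y \<in> rectangle c (angle n) l s. ennreal \<bar>f y\<bar> \<partial>lborel)
      = (\<integral>\<^sup>+ y \<in> rectangle c (angle n) l s. F y \<partial>lborel)"
    by (intro nn_integral_cong_AE) (use eq in \<open>eventually_elim, simp\<close>)
  also have "\<dots> \<le> (\<integral>\<^sup>+ y \<in> ?B. F y \<partial>lborel)"
    using sub by (intro nn_integral_mono) (auto simp: indicator_def)
  also have "\<dots> \<le> ennreal (4 * (fst c + l - (fst c - s)) * (snd c + 2 * s - snd c)) * strong_maximal F x"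
  proof (rule box_le_strong_maximal)
    have "x \<in> ?B" using sub x unfolding s_def by blast
    then show "fst x \<in> {fst c - s..fst c + l}" "snd x \<in> {snd c..snd c + 2 * s}"
      by (simp_all only: mem_Times_iff)
  qed (use F s l in auto)
  \<comment> \<open>The box measures \<open>l + s \<le> 2 * l\<close> by \<open>2 * s\<close>, so
    its area is at most 4 times that of the rectangle; \<open>box_le_strong_maximal\<close>
    contributes the other 4.\<close>
  also have "\<dots> \<le> ennreal (16 * (l * s)) * strong_maximal F x"
    using s by (intro mult_right_mono ennreal_leI) (auto simp: algebra_simps mult_left_mono)
  finally have "(\<integral>\<^sup>+ y \<in> rectangle c (angle n) l s. ennreal \<bar>f y\<bar> \<partial>lborel) / ennreal (l * s)
      \<le> ennreal (16 * (l * s)) * strong_maximal F x / ennreal (l * s)"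
    by (rule divide_right_mono_ennreal)
  also have "\<dots> = ennreal 16 * strong_maximal F x * ennreal (l * s) / ennreal (l * s)"
    using s by (simp add: ennreal_mult mult_ac)
  also have "\<dots> = ennreal 16 * strong_maximal F x"
    using s l by (intro mult_divide_eq_ennreal) auto
  finally show "(\<integral>\<^sup>+ y \<in> rectangle c (angle n) l (l * ecc n). ennreal \<bar>f y\<bar> \<partial>lborel) / ennreal (l * (l * ecc n))
      \<le> ennreal 16 * strong_maximal F x"
    unfolding s_def .
qed

lemma open_maximal_op_greater: "open {x. t < maximal_op (rect_family a b) f x}"
proof (subst open_subopen, clarify)
  fix x assume "t < maximal_op (rect_family a b) f x"
  then obtain c l n where n: "1 \<le> n" and l: "0 < l" and x: "x \<in> rectangle c (angle n) l (l * ecc n)"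
    and t: "t < (\<integral>\<^sup>+ y \<in> rectangle c (angle n) l (l * ecc n). ennreal \<bar>f y\<bar> \<partial>lborel) / ennreal (l * (l * ecc n))"
    (is "_ < ?I / _")
    unfolding maximal_op_eq less_SUP_iff by auto
  have e: "0 < ecc n" using ecc_bounds[OF n] by simp
  define w where "w = angle n"
  \<comment> \<open>A finite average changes continuously as the area grows, so the strict
    inequality survives a small enlargement.\<close>
  have "\<exists>h>0. t < ?I / ennreal ((l + 2 * h) * ((l + 2 * h) * ecc n))"
  proof (cases ?I)
    case (real r)
    have "t < ennreal (r / (l * (l * ecc n)))"
      using t real l e by (simp add: divide_ennreal)
    then obtain t' where t': "t = ennreal t'" "0 \<le> t'" "t' < r / (l * (l * ecc n))"
      by (cases t) (auto simp: ennreal_less_iff)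
    have "((\<lambda>h. r / ((l + 2 * h) * ((l + 2 * h) * ecc n))) \<longlongrightarrow> r / ((l + 2 * 0) * ((l + 2 * 0) * ecc n))) (at_right 0)"
      using l e by (intro tendsto_intros) auto
    then have "eventually (\<lambda>h. t' < r / ((l + 2 * h) * ((l + 2 * h) * ecc n))) (at_right 0)"
      using t' by (intro order_tendstoD(1)) auto
    moreover have "eventually (\<lambda>h. 0 < h) (at_right (0 :: real))"
      by (rule eventually_at_right_less)
    ultimately obtain h where h: "t' < r / ((l + 2 * h) * ((l + 2 * h) * ecc n))" "0 < h"
      using eventually_happens[OF eventually_conj] trivial_limit_at_right_real by blast
    then have "t < ?I / ennreal ((l + 2 * h) * ((l + 2 * h) * ecc n))"
      using t' l e real by (simp add: divide_ennreal ennreal_less_iff)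
    with h show ?thesis by blast
  next
    case top
    have "t < top" by (rule order.strict_trans2[OF t top_greatest])
    moreover have "?I / ennreal ((l + 2 * 1) * ((l + 2 * 1) * ecc n)) = top"
      using top by (simp add: ennreal_top_divide)
    ultimately show ?thesis
      by (intro exI[of _ 1]) auto
  qed
  then obtain h where h: "0 < h" "t < ?I / ennreal ((l + 2 * h) * ((l + 2 * h) * ecc n))"
    by blast
  \<comment> \<open>The corner moves back so that the rectangle grows by \<open>h\<close> at both
    ends and by \<open>h * ecc n\<close> on both long sides. This keeps the eccentricity, hence
    membership in the family.\<close>
  define c' where "c' = c - h *\<^sub>R (cos w, sin w) - (h * ecc n) *\<^sub>R (- sin w, cos w)"
  define U where "U p = (fst p - fst c) * cos w + (snd p - snd c) * sin w" for p :: plane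
  define V where "V p = (snd p - snd c) * cos w - (fst p - fst c) * sin w" for p :: plane
  let ?R = "rectangle c' w (l + 2 * h) ((l + 2 * h) * ecc n)"
  have mem: "p \<in> ?R \<longleftrightarrow> U p + h \<in> {0..l + 2 * h} \<and> V p + h * ecc n \<in> {0..(l + 2 * h) * ecc n}" for p
  proof -
    have "fst c' = fst c - h * cos w + h * ecc n * sin w" "snd c' = snd c - h * sin w - h * ecc n * cos w"
      by (simp_all add: c'_def)
    then have "(fst p - fst c') * cos w + (snd p - snd c') * sin w = U p + h * ((cos w)\<^sup>2 + (sin w)\<^sup>2)"
      "(snd p - snd c') * cos w - (fst p - fst c') * sin w = V p + h * ecc n * ((cos w)\<^sup>2 + (sin w)\<^sup>2)"
      unfolding U_def V_def by algebra+
    then show ?thesis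
      unfolding mem_rectangle_iff by (simp del: atLeastAtMost_iff)
  qed
  \<comment> \<open>The interior of the enlarged rectangle.\<close>
  define T where "T = {p. - h < U p} \<inter> {p. U p < l + h} \<inter> {p. - (h * ecc n) < V p} \<inter> {p. V p < (l + h) * ecc n}"
  have "open T"
    unfolding T_def U_def V_def by (intro open_Int open_Collect_less continuous_intros)
  moreover have "x \<in> T"
  proof -
    have "0 < h * ecc n" using h e by simp
    moreover have "0 \<le> U x" "U x \<le> l" "0 \<le> V x" "V x \<le> l * ecc n"
      using x by (auto simp: mem_rectangle_iff U_def V_def w_def)
    ultimately show ?thesis
      using h by (auto simp: T_def distrib_right)
  qed
  moreover have "T \<subseteq> {x. t < maximal_op (rect_family a b) f x}"
  proof clarify
    fix y assume "y \<in> T"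
    then have y: "y \<in> ?R"
      unfolding mem by (auto simp: T_def algebra_simps)
    have "rectangle c w l (l * ecc n) \<subseteq> ?R"
    proof
      fix p assume "p \<in> rectangle c w l (l * ecc n)"
      then have "U p \<in> {0..l}" "V p \<in> {0..l * ecc n}"
        unfolding mem_rectangle_iff U_def V_def by blast+
      moreover have "0 < h * ecc n" using h e by simp
      moreover have "(l + 2 * h) * ecc n = l * ecc n + 2 * (h * ecc n)"
        by (simp add: algebra_simps)
      ultimately show "p \<in> ?R"
        using h unfolding mem by auto
    qed
    then have "?I \<le> (\<integral>\<^sup>+ y \<in> ?R. ennreal \<bar>f y\<bar> \<partial>lborel)"
      by (intro nn_integral_mono) (auto simp: indicator_def w_def)
    then have "?I / ennreal ((l + 2 * h) * ((l + 2 * h) * ecc n))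
        \<le> (\<integral>\<^sup>+ y \<in> ?R. ennreal \<bar>f y\<bar> \<partial>lborel) / ennreal ((l + 2 * h) * ((l + 2 * h) * ecc n))"
      by (rule divide_right_mono_ennreal)
    also have "\<dots> \<le> maximal_op (rect_family a b) f y"
      using n l h y unfolding w_def by (intro maximal_op_ge) auto
    finally show "t < maximal_op (rect_family a b) f y"
      using h(2) by simp
  qed
  ultimately show "\<exists>T. open T \<and> x \<in> T \<and> T \<subseteq> {x. t < maximal_op (rect_family a b) f x}"
    by blast
qed

lemma measurable_maximal_op [measurable]: "maximal_op (rect_family a b) f \<in> borel_measurable borel"
  by (rule borel_measurableI_greater) (simp add: open_maximal_op_greater)

lemma maximal_op_le_one:
  assumes "AE y in lborel. ennreal \<bar>f y\<bar> \<le> 1"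
  shows "maximal_op (rect_family a b) f x \<le> 1"
  unfolding maximal_op_eq
proof (rule SUP_least, clarify)
  fix c and l :: real and n :: nat
  assume n: "1 \<le> n" and l: "0 < l"
  let ?R = "rectangle c (angle n) l (l * ecc n)"
  have "(\<integral>\<^sup>+ y \<in> ?R. ennreal \<bar>f y\<bar> \<partial>lborel) \<le> (\<integral>\<^sup>+ y. indicator ?R y \<partial>lborel)"
    by (intro nn_integral_mono_AE) (use assms in \<open>eventually_elim, simp add: indicator_def\<close>)
  also have "\<dots> = ennreal (l * (l * ecc n))"
    using n l angle_bounds[of n] ecc_bounds[of n] by (simp add: emeasure_rectangle)
  finally have "(\<integral>\<^sup>+ y \<in> ?R. ennreal \<bar>f y\<bar> \<partial>lborel) / ennreal (l * (l * ecc n))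
     \<le> ennreal (l * (l * ecc n)) / ennreal (l * (l * ecc n))"
    by (rule divide_right_mono_ennreal)
  also have "\<dots> = 1"
    using l ecc_bounds[OF n] by (simp add: divide_ennreal)
  finally show "(\<integral>\<^sup>+ y \<in> ?R. ennreal \<bar>f y\<bar> \<partial>lborel) / ennreal (l * (l * ecc n)) \<le> 1" .
qed

lemma bounded_on_Lp_if_le:
  assumes "a \<le> b" and p: "1 < p"
  shows "bounded_on_Lp p (maximal_op (rect_family a b))"
proof (cases "p = \<infinity>")
  case True
  have "Lp_norm p (maximal_op (rect_family a b) f) \<le> 1"
    if f: "f \<in> borel_measurable lebesgue" "Lp_norm p (\<lambda>x. ennreal \<bar>f x\<bar>) = 1" for f
  proof -
    have "AE y in lebesgue. ennreal \<bar>f y\<bar> \<le> 1"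
      using esssup_AE[of "\<lambda>x. ennreal \<bar>f x\<bar>" lebesgue] f(2) True by (simp add: Lp_norm_def)
    then have "AE y in lborel. ennreal \<bar>f y\<bar> \<le> 1"
      by (simp add: AE_completion_iff)
    then show ?thesis
      using True by (auto simp: Lp_norm_def intro!: esssup_I maximal_op_le_one measurable_completion)
  qed
  then have "op_norm p (maximal_op (rect_family a b)) \<le> 1"
    unfolding op_norm_def by (intro SUP_least) auto
  then show ?thesis
    unfolding bounded_on_Lp_def by (rule order.strict_trans1) simp
next
  case False
  then obtain q where p_eq: "p = ennreal q" and q: "1 < q"
    using p by (cases p) (auto simp: top_unique ennreal_less_iff simp flip: ennreal_1)
  define C where "C = ennreal (10 * q * 2 powr (q - 1) / (q - 1))"
  \<comment> \<open>\<open>C\<close> is the one-dimensional constant, used once per coordinate;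
    \<open>16 powr q\<close> comes from the domination by \<open>strong_maximal\<close>.\<close>
  define K where "K = ennreal (16 powr q) * (C * C)"
  have "Lp_norm p (maximal_op (rect_family a b) f) \<le> epowr K (1 / q)"
    if f: "f \<in> borel_measurable lebesgue" "Lp_norm p (\<lambda>x. ennreal \<bar>f x\<bar>) = 1" for f
  proof -
    \<comment> \<open>A Borel representative is needed because sections of a merely Lebesgue
      measurable function may fail to be measurable.\<close>
    obtain g where g: "g \<in> borel_measurable lborel" "AE x in lborel. f x = g x"
      using completion_ex_borel_measurable_real[OF f(1)] by blast
    define F where "F x = ennreal \<bar>g x\<bar>" for x
    have F [measurable]: "F \<in> borel_measurable borel"
      using g(1) unfolding F_def by simp
    have eq: "AE y in lborel. ennreal \<bar>f y\<bar> = F y"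
      using g(2) by eventually_elim (simp add: F_def)
    have "epowr (\<integral>\<^sup>+ x. epowr (ennreal \<bar>f x\<bar>) q \<partial>lborel) (1 / q) = 1"
      using f(2) q by (simp add: Lp_norm_def p_eq nn_integral_completion)
    then have one: "(\<integral>\<^sup>+ x. epowr (ennreal \<bar>f x\<bar>) q \<partial>lborel) = 1"
      using q epowr_epowr_inverse[of "1 / q" "\<integral>\<^sup>+ x. epowr (ennreal \<bar>f x\<bar>) q \<partial>lborel"]
      by (simp add: epowr_one)
    have "(\<integral>\<^sup>+ x. epowr (maximal_op (rect_family a b) f x) q \<partial>lborel)
       \<le> (\<integral>\<^sup>+ x. epowr (ennreal 16 * strong_maximal F x) q \<partial>lborel)"
      using q by (intro nn_integral_mono epowr_mono maximal_op_le_strong_maximal[OF \<open>a \<le> b\<close> F eq]) auto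
    also have "\<dots> = ennreal (16 powr q) * (\<integral>\<^sup>+ x. epowr (strong_maximal F x) q \<partial>lborel)"
      using q by (subst epowr_mult_const) (auto simp: nn_integral_cmult)
    also have "\<dots> \<le> ennreal (16 powr q) * (C * C * (\<integral>\<^sup>+ x. epowr (F x) q \<partial>lborel))"
      unfolding C_def using q by (intro mult_left_mono strong_maximal_strong) auto
    also have "(\<integral>\<^sup>+ x. epowr (F x) q \<partial>lborel) = (\<integral>\<^sup>+ x. epowr (ennreal \<bar>f x\<bar>) q \<partial>lborel)"
      by (intro nn_integral_cong_AE) (use eq in \<open>eventually_elim, simp\<close>)
    also have "\<dots> = 1" by (rule one)
    finally show ?thesis
      using q by (auto simp: Lp_norm_def p_eq nn_integral_completion K_def intro!: epowr_mono)
  qed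
  then have "op_norm p (maximal_op (rect_family a b)) \<le> epowr K (1 / q)"
    unfolding op_norm_def by (intro SUP_least) auto
  also have "\<dots> < \<infinity>"
    by (intro epowr_finite) (simp add: K_def C_def ennreal_mult_less_top)
  finally show ?thesis
    unfolding bounded_on_Lp_def .
qed

end

section \<open>A Kakeya set\<close>

text \<open>Thickness is measured vertically, so areas and overlaps are read off at each abscissa.
  The bounds \<open>\<alpha>\<close> and \<open>\<beta>\<close> are independent because truncating
  digits errs to one side only.\<close>

definition strip :: "real \<Rightarrow> real \<Rightarrow> (real \<Rightarrow> real) \<Rightarrow> real \<Rightarrow> real \<Rightarrow> plane set" where
  "strip u v g \<alpha> \<beta> = {p. fst p \<in> {u..v} \<and> snd p - g (fst p) \<in> {\<alpha>..\<beta>}}"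

lemma sets_strip:
  assumes "continuous_on UNIV g"
  shows "strip u v g \<alpha> \<beta> \<in> sets borel"
proof -
  have g: "continuous_on UNIV (\<lambda>p :: plane. g (fst p))"
    by (rule continuous_on_compose2[OF assms]) (auto intro: continuous_intros)
  have "strip u v g \<alpha> \<beta> = {p. u \<le> fst p} \<inter> {p. fst p \<le> v} \<inter>
      {p. \<alpha> \<le> snd p - g (fst p)} \<inter> {p. snd p - g (fst p) \<le> \<beta>}"
    by (auto simp: strip_def)
  also have "closed \<dots>"
    by (intro closed_Int closed_Collect_le continuous_intros g)
  finally show ?thesis by (rule borel_closed)
qed

lemma emeasure_strip:
  assumes g: "continuous_on UNIV g" and "u \<le> v" "\<alpha> \<le> \<beta>"
  shows "emeasure lborel (strip u v g \<alpha> \<beta>) = ennreal ((v - u) * (\<beta> - \<alpha>))"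
proof -
  have "emeasure lborel (strip u v g \<alpha> \<beta>) = (\<integral>\<^sup>+ p. indicator (strip u v g \<alpha> \<beta>) p \<partial>lborel)"
    using sets_strip[OF g] by simp
  also have "\<dots> = (\<integral>\<^sup>+ x. \<integral>\<^sup>+ y. indicator (strip u v g \<alpha> \<beta>) (x, y) \<partial>lborel \<partial>lborel)"
    using sets_strip[OF g] by (intro nn_integral_plane(1)) simp
  also have "\<dots> = (\<integral>\<^sup>+ x. \<integral>\<^sup>+ y. indicator {u..v} x * indicator {\<alpha> + g x..\<beta> + g x} y \<partial>lborel \<partial>lborel)"
    by (intro nn_integral_cong) (auto simp: strip_def indicator_def)
  also have "\<dots> = ennreal ((v - u) * (\<beta> - \<alpha>))"
    using assms by (simp add: nn_integral_cmult nn_integral_multc ennreal_mult)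
  finally show ?thesis .
qed

text \<open>Keich's Kakeya construction. The binary digits of the slope of a line are the elements of \<open>A\<close>;
  the digit of weight \<open>2\<^sup>-\<^sup>i\<^sup>-\<^sup>1\<close> does not affect the height of the line at \<open>x = i / N\<close>.\<close>

definition kakeya_line :: "nat \<Rightarrow> nat set \<Rightarrow> real \<Rightarrow> real" where
  "kakeya_line N A x = (\<Sum>i\<in>A. (1/2) ^ Suc i * (x - real i / real N))"

definition kakeya_slope :: "nat set \<Rightarrow> real" where
  "kakeya_slope A = (\<Sum>i\<in>A. (1/2) ^ Suc i)"

lemma continuous_kakeya_line: "continuous_on UNIV (\<lambda>x. t * kakeya_line N A x)"
  unfolding kakeya_line_def by (intro continuous_intros)

lemma kakeya_line_diff: "kakeya_line N A x - kakeya_line N A x' = kakeya_slope A * (x - x')"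
  unfolding kakeya_line_def kakeya_slope_def sum_subtractf[symmetric] sum_distrib_right
  by (intro sum.cong) (simp_all add: algebra_simps del: power_Suc)

lemma sum_half_powers:
  "(\<Sum>i<n. (1/2 :: real) ^ Suc i) = 1 - (1/2) ^ n"
  by (induction n) (auto simp: field_simps)

lemma kakeya_slope_bounds:
  assumes "A \<subseteq> {..<N}"
  shows "0 \<le> kakeya_slope A" "kakeya_slope A \<le> 1"
proof -
  show "0 \<le> kakeya_slope A"
    unfolding kakeya_slope_def by (intro sum_nonneg) auto
  have "kakeya_slope A \<le> (\<Sum>i<N. (1/2) ^ Suc i)"
    unfolding kakeya_slope_def using assms by (intro sum_mono2) auto
  also have "\<dots> \<le> 1"
    unfolding sum_half_powers by simp
  finally show "kakeya_slope A \<le> 1" .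
qed

text \<open>A partial sum of the series of \<open>m * (1/2)^m\<close>, shifted by \<open>j\<close>.
  The closed form shows the bound \<open>(1/2) ^ j\<close>, uniform in \<open>k\<close>.\<close>

lemma sum_index_half_powers:
  "(\<Sum>i\<in>{j<..<j + 1 + k}. (1/2 :: real) ^ Suc i * (real i - real j)) = (1/2) ^ Suc j * (2 - (real k + 2) * (1/2) ^ k)"
proof (induction k)
  case (Suc k)
  have "{j<..<j + 1 + Suc k} = insert (j + 1 + k) {j<..<j + 1 + k}" by auto
  then have "(\<Sum>i\<in>{j<..<j + 1 + Suc k}. (1/2 :: real) ^ Suc i * (real i - real j))
     = (1/2) ^ Suc (j + 1 + k) * (real (j + 1 + k) - real j) + (1/2) ^ Suc j * (2 - (real k + 2) * (1/2) ^ k)"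
    using Suc by simp
  also have "\<dots> = (1/2) ^ Suc j * (2 - (real (Suc k) + 2) * (1/2) ^ Suc k)"
    by (simp add: power_add field_simps)
  finally show ?case .
next
  case 0
  have "{j<..<j + 1 + 0} = {}" by auto
  then show ?case by simp
qed

text \<open>For \<open>x\<close> near \<open>j / N\<close> the digits after the first \<open>j + 1\<close> matter little, so the \<open>2\<^sup>N\<close> lines
  cluster around \<open>2\<^sup>j\<^sup>+\<^sup>1\<close> of them.\<close>

lemma kakeya_line_truncate:
  assumes A: "A \<subseteq> {..<N}" and j: "j < N" and x: "x \<in> {real j / real N..real (Suc j) / real N}"
  shows "kakeya_line N (A \<inter> {..j}) x - kakeya_line N A x \<in> {0..(1/2) ^ j / real N}"
proof -
  have N: "0 < real N" using j by simp
  have fin: "finite A" using A finite_subset by blast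
  define D where "D = A \<inter> {j<..<N}"
  have "A = (A \<inter> {..j}) \<union> D"
    using A unfolding D_def by auto
  then have "kakeya_line N A x = kakeya_line N (A \<inter> {..j} \<union> D) x" by simp
  also have "\<dots> = kakeya_line N (A \<inter> {..j}) x + kakeya_line N D x"
    unfolding kakeya_line_def using fin by (intro sum.union_disjoint) (auto simp: D_def)
  finally have "kakeya_line N (A \<inter> {..j}) x - kakeya_line N A x = - kakeya_line N D x" by simp
  also have "\<dots> = (\<Sum>i\<in>D. (1/2) ^ Suc i * (real i / real N - x))"
    unfolding kakeya_line_def sum_negf[symmetric] by (intro sum.cong) (simp_all add: algebra_simps del: power_Suc)
  finally have eq: "kakeya_line N (A \<inter> {..j}) x - kakeya_line N A x = (\<Sum>i\<in>D. (1/2) ^ Suc i * (real i / real N - x))" .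
  \<comment> \<open>A dropped digit has index at least \<open>j + 1\<close>, so its zero
    \<open>i / N\<close> lies to the right of \<open>x\<close>; all dropped terms therefore have the
    same sign.\<close>
  have bounds: "0 \<le> real i / real N - x" "real i / real N - x \<le> (real i - real j) / real N" if "i \<in> D" for i
  proof -
    have "real (Suc j) / real N \<le> real i / real N"
      using that N unfolding D_def by (intro divide_right_mono) auto
    with x show "0 \<le> real i / real N - x" by simp
    show "real i / real N - x \<le> (real i - real j) / real N"
      using x by (simp add: diff_divide_distrib)
  qed
  have "0 \<le> (\<Sum>i\<in>D. (1/2) ^ Suc i * (real i / real N - x))"
    using bounds(1) by (intro sum_nonneg mult_nonneg_nonneg) auto
  moreover have "(\<Sum>i\<in>D. (1/2) ^ Suc i * (real i / real N - x)) \<le> (1/2) ^ j / real N"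
  proof -
    have "(\<Sum>i\<in>D. (1/2) ^ Suc i * (real i / real N - x)) \<le> (\<Sum>i\<in>D. (1/2) ^ Suc i * ((real i - real j) / real N))"
      using bounds(2) by (intro sum_mono mult_left_mono) auto
    also have "\<dots> \<le> (\<Sum>i\<in>{j<..<j + 1 + (N - j - 1)}. (1/2) ^ Suc i * ((real i - real j) / real N))"
      using j N unfolding D_def by (intro sum_mono2 mult_nonneg_nonneg divide_nonneg_pos) auto
    also have "\<dots> = (\<Sum>i\<in>{j<..<j + 1 + (N - j - 1)}. (1/2) ^ Suc i * (real i - real j)) / real N"
      by (simp add: sum_divide_distrib)
    also have "\<dots> \<le> (1/2) ^ j / real N"
      unfolding sum_index_half_powers using N by (intro divide_right_mono) auto
    finally show ?thesis .
  qed
  ultimately show ?thesis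
    unfolding eq by simp
qed

text \<open>Past \<open>x = 2\<close> all digits keep a positive weight that decreases with the index, so the lines stay as far
  apart as the smallest difference of their slopes.\<close>

lemma kakeya_line_separated:
  assumes A: "A \<subseteq> {..<N}" and B: "B \<subseteq> {..<N}" and "A \<noteq> B" and x: "2 \<le> x"
  shows "(1/2) ^ N \<le> \<bar>kakeya_line N A x - kakeya_line N B x\<bar>"
proof -
  \<comment> \<open>At the first differing digit \<open>i\<close>, \<open>A\<close> gains
    \<open>(1/2) ^ Suc i * c i\<close>, while the later digits of \<open>B\<close> recover at most
    \<open>((1/2) ^ Suc i - (1/2) ^ N) * c i\<close>, since \<open>c\<close> decreases. The deficit
    is at least \<open>(1/2) ^ N\<close> because \<open>2 \<le> x\<close> gives
    \<open>1 \<le> c i\<close>.\<close>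
  have *: "(1/2) ^ N \<le> kakeya_line N A x - kakeya_line N B x"
    if A: "A \<subseteq> {..<N}" and B: "B \<subseteq> {..<N}" and i: "i \<in> A" "i \<notin> B" and eq: "A \<inter> {..<i} = B \<inter> {..<i}" for A B i
  proof -
    have fin: "finite A" "finite B" using A B finite_subset by blast+
    have iN: "i < N" using i A by auto
    define c where "c m = x - real m / real N" for m
    have c1: "1 \<le> c i"
    proof -
      have "real i / real N \<le> 1" using iN by simp
      with x show ?thesis by (simp add: c_def)
    qed
    have c0: "0 \<le> c m" if "m < N" for m
    proof -
      have "real m / real N \<le> 1" using that by simp
      with x show ?thesis by (simp add: c_def)
    qed
    have cm: "c m \<le> c i" if "i < m" for m
    proof -
      have "real i / real N \<le> real m / real N"
        using that by (intro divide_right_mono) auto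
      then show ?thesis by (simp add: c_def)
    qed
    have "A = insert i (A \<inter> {..<i} \<union> A \<inter> {i<..})"
      using i by auto
    then have "kakeya_line N A x = kakeya_line N (insert i (A \<inter> {..<i} \<union> A \<inter> {i<..})) x" by simp
    also have "\<dots> = (1/2) ^ Suc i * c i + kakeya_line N (A \<inter> {..<i} \<union> A \<inter> {i<..}) x"
      unfolding kakeya_line_def using fin by (subst sum.insert) (auto simp: c_def)
    also have "kakeya_line N (A \<inter> {..<i} \<union> A \<inter> {i<..}) x = kakeya_line N (A \<inter> {..<i}) x + kakeya_line N (A \<inter> {i<..}) x"
      unfolding kakeya_line_def using fin by (intro sum.union_disjoint) auto
    finally have lA: "kakeya_line N A x = (1/2) ^ Suc i * c i + (kakeya_line N (A \<inter> {..<i}) x + kakeya_line N (A \<inter> {i<..}) x)" .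
    have "0 \<le> kakeya_line N (A \<inter> {i<..}) x"
      unfolding kakeya_line_def c_def[symmetric] using A c0
      by (intro sum_nonneg mult_nonneg_nonneg) auto
    with lA have lA': "(1/2) ^ Suc i * c i + kakeya_line N (A \<inter> {..<i}) x \<le> kakeya_line N A x"
      by simp
    have "B = B \<inter> {..<i} \<union> B \<inter> {i<..}"
    proof (intro set_eqI iffI)
      fix m assume "m \<in> B"
      then have "m \<noteq> i" using i by auto
      then show "m \<in> B \<inter> {..<i} \<union> B \<inter> {i<..}" using \<open>m \<in> B\<close> by auto
    qed auto
    then have "kakeya_line N B x = kakeya_line N (B \<inter> {..<i} \<union> B \<inter> {i<..}) x" by simp
    also have "\<dots> = kakeya_line N (B \<inter> {..<i}) x + kakeya_line N (B \<inter> {i<..}) x"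
      unfolding kakeya_line_def using fin by (intro sum.union_disjoint) auto
    finally have lB: "kakeya_line N B x = kakeya_line N (A \<inter> {..<i}) x + kakeya_line N (B \<inter> {i<..}) x"
      by (simp add: eq)
    have "kakeya_line N (B \<inter> {i<..}) x \<le> (\<Sum>m\<in>B \<inter> {i<..}. (1/2) ^ Suc m * c i)"
      unfolding kakeya_line_def c_def[symmetric] using cm by (intro sum_mono mult_left_mono) auto
    also have "\<dots> \<le> (\<Sum>m\<in>{..<N} - {..<Suc i}. (1/2) ^ Suc m * c i)"
      using B c1 by (intro sum_mono2) auto
    also have "\<dots> = (\<Sum>m\<in>{..<N} - {..<Suc i}. (1/2) ^ Suc m) * c i"
      by (rule sum_distrib_right[symmetric])
    also have "(\<Sum>m\<in>{..<N} - {..<Suc i}. (1/2 :: real) ^ Suc m) = (1/2) ^ Suc i - (1/2) ^ N"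
      using iN by (subst sum_diff, simp, simp) (simp add: sum_half_powers del: power_Suc)
    finally have "kakeya_line N (B \<inter> {i<..}) x \<le> (1/2) ^ Suc i * c i - (1/2) ^ N * c i"
      by (simp add: algebra_simps)
    moreover have "(1/2) ^ N * 1 \<le> (1/2) ^ N * c i"
      using c1 by (intro mult_left_mono) auto
    ultimately show ?thesis
      using lA' lB unfolding mult_1_right by linarith
  qed
  define i where "i = (LEAST m. m \<in> A \<longleftrightarrow> m \<notin> B)"
  have ex: "\<exists>m. m \<in> A \<longleftrightarrow> m \<notin> B" using \<open>A \<noteq> B\<close> by blast
  have i: "i \<in> A \<longleftrightarrow> i \<notin> B"
    unfolding i_def by (rule LeastI_ex[OF ex])
  have "m \<in> A \<longleftrightarrow> m \<in> B" if "m < i" for m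
    using not_less_Least[of m "\<lambda>m. m \<in> A \<longleftrightarrow> m \<notin> B"] that unfolding i_def by blast
  then have eq: "A \<inter> {..<i} = B \<inter> {..<i}" by auto
  show ?thesis
  proof (cases "i \<in> A")
    case True
    then show ?thesis using *[OF A B _ _ eq] i by simp
  next
    case False
    then show ?thesis using *[OF B A _ _ eq[symmetric]] i by simp
  qed
qed

section \<open>Measures of the Kakeya set and of its continuation\<close>

lemma sum_Pow_const:
  assumes "finite S" "0 \<le> x"
  shows "(\<Sum>A\<in>Pow S. ennreal x) = ennreal (2 ^ card S * x)"
proof -
  have "ennreal (2 ^ card S * x) = ennreal (2 ^ card S) * ennreal x"
    using assms by (intro ennreal_mult) auto
  also have "ennreal (2 ^ card S) = 2 ^ card S"
    by (simp flip: ennreal_power)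
  finally show ?thesis
    using assms by (simp add: card_Pow)
qed

text \<open>\<open>t\<close> flattens the figure to the available slopes. The half-height of 10
  units \<open>t * (1/2) ^ N\<close> absorbs the errors in \<open>maximal_op_kakeya\<close>, which
  add up to at most 9.25 units.\<close>

definition kakeya_set :: "nat \<Rightarrow> real \<Rightarrow> plane set" where
  "kakeya_set N t = (\<Union>A\<in>Pow {..<N}. strip 0 1 (\<lambda>x. t * kakeya_line N A x) (- (10 * t * (1/2) ^ N)) (10 * t * (1/2) ^ N))"

text \<open>A quarter of the separation of the lines as half-height keeps the tubes
  disjoint.\<close>

definition kakeya_reach :: "nat \<Rightarrow> real \<Rightarrow> plane set" where
  "kakeya_reach N t = (\<Union>A\<in>Pow {..<N}. strip 2 3 (\<lambda>x. t * kakeya_line N A x) (- (t * (1/2) ^ N / 4)) (t * (1/2) ^ N / 4))"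

lemma sets_kakeya [measurable]: "kakeya_set N t \<in> sets borel" "kakeya_reach N t \<in> sets borel"
  unfolding kakeya_set_def kakeya_reach_def
  by (intro sets.finite_UN finite_Pow_iff[THEN iffD2] finite_lessThan sets_strip continuous_kakeya_line)+

lemma emeasure_kakeya_reach:
  assumes "0 < t"
  shows "emeasure lborel (kakeya_reach N t) = ennreal (t / 2)"
proof -
  let ?S = "\<lambda>A. strip 2 3 (\<lambda>x. t * kakeya_line N A x) (- (t * (1/2) ^ N / 4)) (t * (1/2) ^ N / 4)"
  have "disjoint_family_on ?S (Pow {..<N})"
    unfolding disjoint_family_on_def
  proof (intro ballI impI equals0I)
    fix A B p assume AB: "A \<in> Pow {..<N}" "B \<in> Pow {..<N}" "A \<noteq> B" and p: "p \<in> ?S A \<inter> ?S B"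
    define d where "d = t * (1/2) ^ N"
    have "0 < d" using assms by (simp add: d_def)
    have "t * (1/2) ^ N \<le> t * \<bar>kakeya_line N A (fst p) - kakeya_line N B (fst p)\<bar>"
      using AB p assms by (intro mult_left_mono kakeya_line_separated) (auto simp: strip_def)
    also have "\<dots> = \<bar>t * kakeya_line N A (fst p) - t * kakeya_line N B (fst p)\<bar>"
      using assms by (simp add: abs_mult flip: right_diff_distrib)
    finally have "d \<le> \<bar>t * kakeya_line N A (fst p) - t * kakeya_line N B (fst p)\<bar>"
      by (simp only: d_def)
    moreover have "\<bar>snd p - t * kakeya_line N A (fst p)\<bar> \<le> d / 4" "\<bar>snd p - t * kakeya_line N B (fst p)\<bar> \<le> d / 4"
    proof -
      have "snd p - t * kakeya_line N A (fst p) \<in> {- (d / 4)..d / 4}" "snd p - t * kakeya_line N B (fst p) \<in> {- (d / 4)..d / 4}"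
        using p by (simp_all add: strip_def d_def)
      then show "\<bar>snd p - t * kakeya_line N A (fst p)\<bar> \<le> d / 4" "\<bar>snd p - t * kakeya_line N B (fst p)\<bar> \<le> d / 4"
        unfolding atLeastAtMost_iff by linarith+
    qed
    ultimately show False
      using \<open>0 < d\<close> by linarith
  qed
  then have "emeasure lborel (kakeya_reach N t) = (\<Sum>A\<in>Pow {..<N}. emeasure lborel (?S A))"
    unfolding kakeya_reach_def by (intro sum_emeasure[symmetric]) (auto intro: sets_strip continuous_kakeya_line)
  also have "\<dots> = (\<Sum>A\<in>Pow {..<N}. ennreal (t * (1/2) ^ N / 2))"
    using assms by (intro sum.cong refl, subst emeasure_strip[OF continuous_kakeya_line]) (auto simp: field_simps)
  also have "\<dots> = ennreal (2 ^ N * (t * (1/2) ^ N / 2))"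
    using assms sum_Pow_const[of "{..<N}" "t * (1/2) ^ N / 2"] by simp
  also have "2 ^ N * (t * (1/2) ^ N / 2) = t / 2"
    by (simp add: power_one_over)
  finally show ?thesis .
qed

text \<open>Over the \<open>j\<close>-th interval of length \<open>1 / N\<close> the lines merge
  into \<open>2 ^ Suc j\<close> strips of height \<open>2 * d + t * (1/2) ^ j / N\<close>. The tube
  heights sum geometrically to at most \<open>40 * t / N\<close>; the truncation errors give
  \<open>2 * t / N\<^sup>2\<close> for each \<open>j\<close>, hence
  \<open>2 * t / N\<close>.\<close>

lemma emeasure_kakeya_set:
  assumes t: "0 < t" and N: "1 \<le> N"
  shows "emeasure lborel (kakeya_set N t) \<le> ennreal (42 * t / real N)"
proof -
  define d where "d = 10 * t * (1/2) ^ N"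
  have d: "0 \<le> d" using t by (simp add: d_def)
  let ?S = "\<lambda>j B. strip (real j / real N) (real (Suc j) / real N) (\<lambda>x. t * kakeya_line N B x)
      (- (d + t * ((1/2) ^ j / real N))) d"
  have "kakeya_set N t \<subseteq> (\<Union>j<N. \<Union>B\<in>Pow {..j}. ?S j B)"
  proof
    fix p assume "p \<in> kakeya_set N t"
    then obtain A where A: "A \<subseteq> {..<N}" and p: "fst p \<in> {0..1}" "\<bar>snd p - t * kakeya_line N A (fst p)\<bar> \<le> d"
      unfolding kakeya_set_def strip_def d_def by (auto simp: abs_le_iff)
    obtain j where j: "j < N" and x: "fst p \<in> {real j / real N..real (Suc j) / real N}"
    proof (cases "fst p = 1")
      \<comment> \<open>Rounding down would give \<open>j = N\<close> here; the right end belongs to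
        the last interval.\<close>
      case True
      with N show ?thesis by (intro that[of "N - 1"]) auto
    next
      case False
      define j where "j = nat \<lfloor>fst p * real N\<rfloor>"
      have "0 \<le> fst p * real N" using p by simp
      then have "real j \<le> fst p * real N" "fst p * real N < real (Suc j)"
      proof -
        have "real j = real_of_int \<lfloor>fst p * real N\<rfloor>"
          using \<open>0 \<le> fst p * real N\<close> by (simp add: j_def)
        then show "real j \<le> fst p * real N" "fst p * real N < real (Suc j)"
          by linarith+
      qed
      moreover have "fst p * real N < 1 * real N"
        using False p N by (intro mult_strict_right_mono) auto
      moreover from calculation have "j < N" by linarith
      ultimately show ?thesis
        using N by (intro that[of j]) (auto simp: field_simps)
    qed
    have "kakeya_line N (A \<inter> {..j}) (fst p) - kakeya_line N A (fst p) \<in> {0..(1/2) ^ j / real N}"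
      by (rule kakeya_line_truncate) fact+
    then have "t * (kakeya_line N (A \<inter> {..j}) (fst p) - kakeya_line N A (fst p)) \<in> {0..t * ((1/2) ^ j / real N)}"
      using t by (auto intro!: mult_left_mono simp del: times_divide_eq_right)
    moreover have "y - \<beta> \<in> {- (d + e)..d}" if "\<bar>y - \<alpha>\<bar> \<le> d" "\<beta> - \<alpha> \<in> {0..e}" for y \<alpha> \<beta> e :: real
      using that by auto
    ultimately have "p \<in> ?S j (A \<inter> {..j})"
      using x p(2) unfolding strip_def right_diff_distrib mem_Collect_eq by blast
    then have "p \<in> (\<Union>B\<in>Pow {..j}. ?S j B)"
      by (rule UN_I[rotated]) simp
    with j show "p \<in> (\<Union>j<N. \<Union>B\<in>Pow {..j}. ?S j B)"
      by (intro UN_I[of j]) auto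
  qed
  then have "emeasure lborel (kakeya_set N t) \<le> emeasure lborel (\<Union>j<N. \<Union>B\<in>Pow {..j}. ?S j B)"
    by (intro emeasure_mono) (auto intro!: sets.finite_UN sets_strip continuous_kakeya_line)
  also have "\<dots> \<le> (\<Sum>j<N. emeasure lborel (\<Union>B\<in>Pow {..j}. ?S j B))"
    by (intro emeasure_subadditive_finite) (auto intro!: sets.finite_UN sets_strip continuous_kakeya_line)
  also have "\<dots> \<le> (\<Sum>j<N. \<Sum>B\<in>Pow {..j}. emeasure lborel (?S j B))"
    by (intro sum_mono emeasure_subadditive_finite) (auto intro!: sets_strip continuous_kakeya_line)
  also have "\<dots> = (\<Sum>j<N. \<Sum>B\<in>Pow {..j}. ennreal (1 / real N * (2 * d + t * ((1/2) ^ j / real N))))"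
  proof (intro sum.cong refl)
    fix j B
    have "emeasure lborel (?S j B) = ennreal ((real (Suc j) / real N - real j / real N) * (d - - (d + t * ((1/2) ^ j / real N))))"
      using d t by (intro emeasure_strip continuous_kakeya_line divide_right_mono) (auto intro: order_trans[of _ 0])
    also have "(real (Suc j) / real N - real j / real N) = 1 / real N"
      by (simp flip: diff_divide_distrib)
    finally show "emeasure lborel (?S j B) = ennreal (1 / real N * (2 * d + t * ((1/2) ^ j / real N)))"
      by simp
  qed
  also have "\<dots> = (\<Sum>j<N. ennreal (2 ^ Suc j * (1 / real N * (2 * d + t * ((1/2) ^ j / real N)))))"
  proof (rule sum.cong[OF refl])
    fix j
    show "(\<Sum>B\<in>Pow {..j}. ennreal (1 / real N * (2 * d + t * ((1/2) ^ j / real N))))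
      = ennreal (2 ^ Suc j * (1 / real N * (2 * d + t * ((1/2) ^ j / real N))))"
      using d t by (subst sum_Pow_const) auto
  qed
  also have "\<dots> = ennreal (\<Sum>j<N. 2 ^ Suc j * (1 / real N * (2 * d + t * ((1/2) ^ j / real N))))"
    using d t by (intro sum_ennreal) auto
  also have "(\<Sum>j<N. 2 ^ Suc j * (1 / real N * (2 * d + t * ((1/2) ^ j / real N))))
     = (\<Sum>j<N. 4 * d / real N * 2 ^ j + 2 * t / (real N * real N))"
    by (intro sum.cong refl) (simp add: field_simps power_one_over)
  also have "\<dots> = 4 * d / real N * (\<Sum>j<N. 2 ^ j) + real N * (2 * t / (real N * real N))"
    by (simp add: sum.distrib sum_distrib_left)
  also have "(\<Sum>j<N. 2 ^ j) = (2 ^ N - 1 :: real)"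
    by (simp add: geometric_sum)
  also have "4 * d / real N * (2 ^ N - 1) + real N * (2 * t / (real N * real N)) \<le> 42 * t / real N"
  proof -
    have "4 * d / real N * (2 ^ N - 1) \<le> 4 * d / real N * 2 ^ N"
      using d by (intro mult_left_mono) auto
    also have "\<dots> = 40 * t / real N"
      by (simp add: d_def power_one_over)
    finally show ?thesis
      using N by (simp add: field_simps)
  qed
  finally show ?thesis
    by (simp add: ennreal_leI)
qed

text \<open>Allows the indicator of the set to be normalised; a single tube suffices.\<close>

lemma emeasure_kakeya_set_pos:
  assumes "0 < t"
  shows "0 < emeasure lborel (kakeya_set N t)"
proof -
  let ?S = "strip 0 1 (\<lambda>x. t * kakeya_line N {} x) (- (10 * t * (1/2) ^ N)) (10 * t * (1/2) ^ N)"
  have "0 < emeasure lborel ?S"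
    using assms by (subst emeasure_strip[OF continuous_kakeya_line]) auto
  also have "\<dots> \<le> emeasure lborel (kakeya_set N t)"
  proof (rule emeasure_mono)
    show "?S \<subseteq> kakeya_set N t"
      unfolding kakeya_set_def by (rule UN_upper) simp
  qed simp
  finally show ?thesis .
qed

section \<open>The case \<open>a > b\<close>\<close>

text \<open>The derivative \<open>1 / cos\<^sup>2\<close> of the tangent lies between 1 and 2 on
  \<open>[0, pi / 4]\<close>.\<close>

lemma tan_diff_bounds:
  fixes x y :: real
  assumes "0 \<le> y" "y \<le> x" "x \<le> pi / 4"
  shows "x - y \<le> tan x - tan y" "tan x - tan y \<le> 2 * (x - y)"
proof -
  have "x - y \<le> tan x - tan y \<and> tan x - tan y \<le> 2 * (x - y)"
  proof (cases "y = x")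
    case False
    with assms have "y < x" by simp
    have cos: "1 / 2 \<le> (cos z)\<^sup>2" "0 < cos z" if "y \<le> z" "z \<le> x" for z
    proof -
      have "cos (pi / 4) \<le> cos z"
        using that assms pi_gt_zero by (intro cos_monotone_0_pi_le) auto
      then have "(cos (pi / 4))\<^sup>2 \<le> (cos z)\<^sup>2"
        by (intro power_mono) (auto simp: cos_45)
      then show "1 / 2 \<le> (cos z)\<^sup>2"
        by (simp add: cos_45 power_divide)
      show "0 < cos z"
      proof (rule cos_gt_zero_pi)
        show "- (pi / 2) < z" "z < pi / 2"
          using that assms pi_gt_zero by linarith+
      qed
    qed
    obtain z where z: "y < z" "z < x" "tan x - tan y = (x - y) * inverse ((cos z)\<^sup>2)"
      using MVT2[OF \<open>y < x\<close>, of tan "\<lambda>z. inverse ((cos z)\<^sup>2)"] cos(2) DERIV_tan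
      by (metis less_irrefl)
    have "inverse ((cos z)\<^sup>2) \<le> inverse (1 / 2)"
      using cos[of z] z by (intro le_imp_inverse_le) auto
    moreover have "inverse 1 \<le> inverse ((cos z)\<^sup>2)"
      using cos[of z] z by (intro le_imp_inverse_le) (auto simp: abs_square_le_1)
    ultimately have "(x - y) * 1 \<le> tan x - tan y" "tan x - tan y \<le> (x - y) * 2"
      unfolding z(3) using \<open>y < x\<close> by (intro mult_left_mono; simp)+
    then show ?thesis by simp
  qed simp
  then show "x - y \<le> tan x - tan y" "tan x - tan y \<le> 2 * (x - y)" by auto
qed

section \<open>Asymptotics of angles and eccentricities, and the lower bound\<close>

context rectangle_exponents
begin

lemma tendsto_angle: "angle \<longlonglongrightarrow> 0"
proof -
  have "(\<lambda>n. pi / 4 * real n powr (- b)) \<longlonglongrightarrow> pi / 4 * 0"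
    using b by (intro tendsto_intros tendsto_neg_powr filterlim_real_sequentially) auto
  then show ?thesis
    by (simp add: angle_def[abs_def] powr_minus_divide)
qed

lemma angle_antimono:
  assumes "1 \<le> m" "m \<le> n"
  shows "angle n \<le> angle m"
  unfolding angle_def using assms b by (intro divide_left_mono mult_left_mono powr_mono2) auto

text \<open>Consecutive angles have ratio \<open>(n / (n + 1)) powr b\<close>, which tends to
  1.\<close>

lemma eventually_angle_gap:
  assumes "0 < e"
  shows "eventually (\<lambda>n. angle n - angle (Suc n) \<le> e * angle n) sequentially"
proof -
  have "(\<lambda>n. (real n / real (Suc n)) powr b) \<longlonglongrightarrow> 1 powr b"
    by (intro tendsto_powr LIMSEQ_n_over_Suc_n tendsto_const) auto
  then have "eventually (\<lambda>n. 1 - e < (real n / real (Suc n)) powr b) sequentially"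
    using assms by (intro order_tendstoD(1)) auto
  then show ?thesis
    using eventually_ge_at_top[of 1]
  proof eventually_elim
    case (elim n)
    have "angle (Suc n) = angle n * (real n / real (Suc n)) powr b"
      using elim(2) by (simp add: angle_def powr_divide)
    moreover have "angle n * (1 - e) \<le> angle n * (real n / real (Suc n)) powr b"
      using elim angle_bounds[of n] by (intro mult_left_mono) auto
    ultimately show ?case
      by (simp add: algebra_simps)
  qed
qed

text \<open>The quotient \<open>ecc n / angle n\<close> is a constant times
  \<open>n powr (b - a)\<close>. This is where \<open>b < a\<close> enters.\<close>

lemma eventually_ecc_small:
  assumes "b < a" "0 < e"
  shows "eventually (\<lambda>n. ecc n \<le> e * angle n) sequentially"
proof -
  have "(\<lambda>n. real n powr (b - a)) \<longlonglongrightarrow> 0"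
    using assms by (intro tendsto_neg_powr filterlim_real_sequentially) auto
  then have "eventually (\<lambda>n. real n powr (b - a) < e * (pi / 4)) sequentially"
    using assms pi_gt_zero by (intro order_tendstoD(2)) auto
  then show ?thesis
    using eventually_ge_at_top[of 1]
  proof eventually_elim
    case (elim n)
    then have "real n powr b / real n powr a \<le> e * (pi / 4)"
      by (simp add: powr_diff)
    then have "real n powr b / real n powr a / real n powr b \<le> e * (pi / 4) / real n powr b"
      by (rule divide_right_mono) simp
    with elim(2) show ?case
      by (simp add: ecc_def angle_def)
  qed
qed

text \<open>Far out in the sequence, the slopes are spaced densely relative to their size and the rectangles
  are thin relative to their slope, so rescaling by the first slope \<open>t\<close> approximates every direction of slope in \<open>[0,1]\<close>.\<close>

lemma exists_scale:
  assumes "b < a" and e: "0 < e"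
  obtains t where "0 < t" "t \<le> 1"
    "\<And>s. 0 \<le> s \<Longrightarrow> s \<le> 1 \<Longrightarrow> \<exists>m\<ge>1. \<bar>tan (angle m) - t * s\<bar> \<le> e * t \<and> ecc m \<le> e * t"
proof -
  \<comment> \<open>The gap is taken with \<open>e / 2\<close> because passing from angles to slopes
    costs a factor 2.\<close>
  have "eventually (\<lambda>n. angle n - angle (Suc n) \<le> e / 2 * angle n \<and> ecc n \<le> e * angle n \<and> 1 \<le> n) sequentially"
    using e \<open>b < a\<close>
    by (intro eventually_conj eventually_angle_gap eventually_ecc_small eventually_ge_at_top) auto
  then obtain n0 where n0: "\<And>n. n0 \<le> n \<Longrightarrow> angle n - angle (Suc n) \<le> e / 2 * angle n \<and> ecc n \<le> e * angle n \<and> 1 \<le> n"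
    unfolding eventually_sequentially by blast
  have one: "1 \<le> n0" using n0 by blast
  define t where "t = tan (angle n0)"
  have ang: "0 < angle n" "angle n \<le> pi / 4" "angle n \<le> angle n0" if "n0 \<le> n" for n
    using angle_bounds[of n] angle_antimono[of n0 n] that one by auto
  have t: "angle n0 \<le> t"
    using tan_diff_bounds(1)[of 0 "angle n0"] ang[of n0] by (simp add: t_def)
  have "t \<le> tan (pi / 4)"
    using tan_diff_bounds(1)[of "angle n0" "pi / 4"] ang[of n0] by (simp add: t_def)
  then have "t \<le> 1" by (simp add: tan_45)
  have "0 < t" using t ang[of n0] by simp
  have small: "e * angle n \<le> e * t" if "n0 \<le> n" for n
    using ang(3)[OF that] t e by (intro mult_left_mono) auto
  have "\<exists>m\<ge>1. \<bar>tan (angle m) - t * s\<bar> \<le> e * t \<and> ecc m \<le> e * t" if s: "0 \<le> s" "s \<le> 1" for s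
  proof -
    have ts: "0 \<le> t * s" "t * s \<le> t" "0 < e * t"
      using s \<open>0 < t\<close> e by (auto simp: mult_left_le)
    have "eventually (\<lambda>n. angle n < e * t / 2) sequentially"
      using ts by (intro order_tendstoD(2)[OF tendsto_angle]) auto
    then obtain n1 where n1: "\<And>n. n1 \<le> n \<Longrightarrow> angle n < e * t / 2"
      unfolding eventually_sequentially by blast
    \<comment> \<open>The first admissible index whose slope has dropped to
      \<open>t * s + e * t\<close>: its predecessor is still above, and one step lowers the slope by
      at most \<open>e * t\<close>, so the target is not jumped over.\<close>
    let ?P = "\<lambda>n. n0 \<le> n \<and> tan (angle n) \<le> t * s + e * t"
    define m where "m = (LEAST n. ?P n)"
    \<comment> \<open>The slopes tend to 0, and the slack \<open>e * t\<close> makes the search end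
      even for \<open>s = 0\<close>.\<close>
    have "?P (max n0 n1)"
      using tan_diff_bounds(2)[of 0 "angle (max n0 n1)"] ang[of "max n0 n1"] n1[of "max n0 n1"] ts by simp
    then have m: "?P m"
      unfolding m_def by (rule LeastI)
    have "t * s - e * t \<le> tan (angle m)"
    proof (cases "m = n0")
      case True
      then show ?thesis using ts by (simp add: t_def)
    next
      case False
      with m obtain k where k: "m = Suc k" "n0 \<le> k" by (cases m) auto
      have "\<not> ?P k"
        using not_less_Least[of k ?P] k by (simp add: m_def)
      then have "t * s + e * t < tan (angle k)" using k by simp
      moreover have "tan (angle k) - tan (angle m) \<le> 2 * (angle k - angle m)"
        using ang[of k] ang[of m] angle_antimono[of k m] one k m by (intro tan_diff_bounds) auto
      moreover have "2 * (angle k - angle m) \<le> e * t"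
        using n0[OF k(2)] small[OF k(2)] unfolding k(1) by simp
      ultimately show ?thesis using ts by linarith
    qed
    moreover have "ecc m \<le> e * t"
      using n0[of m] small[of m] m by linarith
    ultimately show ?thesis
      using m one by (intro exI[of _ m]) (auto simp: abs_le_iff)
  qed
  with \<open>0 < t\<close> \<open>t \<le> 1\<close> show ?thesis by (rule that)
qed

text \<open>The rectangle runs back from \<open>P\<close> along the approximating direction to
  abscissa 0. Its portion \<open>?R'\<close>, whose lower edge lies over \<open>[1/2, 1]\<close>,
  stays in the Kakeya set and is a fraction \<open>1 / (2 * fst P) \<ge> 1/6\<close> of it.\<close>

lemma maximal_op_kakeya:
  assumes t: "0 < t" "t \<le> 1" and N: "3 \<le> N"
    and approx: "\<And>s. 0 \<le> s \<Longrightarrow> s \<le> 1 \<Longrightarrow> \<exists>m\<ge>1. \<bar>tan (angle m) - t * s\<bar> \<le> (1/2) ^ N * t \<and> ecc m \<le> (1/2) ^ N * t"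
    and k: "0 < k" and P: "P \<in> kakeya_reach N t"
  shows "ennreal (k / 6) \<le> maximal_op (rect_family a b) (\<lambda>x. k * indicator (kakeya_set N t) x) P"
proof -
  define d where "d = (1/2) ^ N * t"
  \<comment> \<open>The thickness of the rectangle shifts points left by at most
    \<open>3 * d\<close>; \<open>d \<le> 1/8\<close> keeps this below the margin 1/2.\<close>
  have "(1/2 :: real) ^ N \<le> (1/2) ^ 3"
    using N by (intro power_decreasing) auto
  then have "(1/2 :: real) ^ N \<le> 1/8" by (simp add: power3_eq_cube)
  then have "(1/2) ^ N * t \<le> 1/8 * 1" using t by (intro mult_mono) auto
  then have d: "0 < d" "d \<le> 1/8" using t by (auto simp: d_def)
  obtain A where A: "A \<subseteq> {..<N}" and P0: "2 \<le> fst P" "fst P \<le> 3"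
    and P1: "\<bar>snd P - t * kakeya_line N A (fst P)\<bar> \<le> d / 4"
  proof -
    obtain A where "A \<subseteq> {..<N}" "P \<in> strip 2 3 (\<lambda>x. t * kakeya_line N A x) (- (d / 4)) (d / 4)"
      using P unfolding kakeya_reach_def d_def mult.commute[of t "(1/2) ^ N"] by blast
    moreover from this have "\<bar>snd P - t * kakeya_line N A (fst P)\<bar> \<le> d / 4"
      unfolding strip_def mem_Collect_eq atLeastAtMost_iff by linarith
    ultimately show ?thesis
      by (intro that[of A]) (auto simp: strip_def)
  qed
  define \<sigma> where "\<sigma> = kakeya_slope A"
  have \<sigma>: "0 \<le> \<sigma>" "\<sigma> \<le> 1" using kakeya_slope_bounds[OF A] by (auto simp: \<sigma>_def)
  obtain m where m: "1 \<le> m" and slope: "\<bar>tan (angle m) - t * \<sigma>\<bar> \<le> d" and em: "ecc m \<le> d"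
    using approx[OF \<sigma>] unfolding d_def by blast
  define w where "w = angle m"
  have w: "0 < w" "w \<le> pi / 4" "0 < cos w" using angle_bounds[OF m] by (auto simp: w_def)
  have tan: "0 \<le> tan w" "tan w \<le> 1"
    using tan_diff_bounds(1)[of 0 w] tan_diff_bounds(1)[of w "pi / 4"] w by (auto simp: tan_45)
  define x0 where "x0 = fst P"
  define l where "l = x0 / cos w"
  have sin: "sin w = tan w * cos w" using w by (simp add: tan_def)
  have l: "0 < l" "l * cos w = x0" using P0 w by (auto simp: l_def x0_def)
  define s where "s = l * ecc m"
  have s: "0 < s" "s * cos w = x0 * ecc m"
    using l ecc_bounds[OF m] by (simp_all add: s_def)
  define c where "c = P - l *\<^sub>R (cos w, sin w)"
  let ?R = "rectangle c w l s"
  \<comment> \<open>The length along the side that advances the abscissa by 1/2. The portion starts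
    at 1/2 rather than 0 because the short side leans to the left.\<close>
  define h where "h = 1 / (2 * cos w)"
  have h: "0 < h" "h * cos w = 1 / 2" using w by (auto simp: h_def)
  have hl: "2 * h \<le> l"
    using P0 w by (simp add: h_def l_def x0_def field_simps)
  let ?R' = "rectangle (c + h *\<^sub>R (cos w, sin w)) w h s"
  have "P \<in> ?R"
    unfolding rectangle_def
  proof (rule CollectI, rule exI[of _ l], rule exI[of _ 0], intro conjI)
    show "P = c + l *\<^sub>R (cos w, sin w) + 0 *\<^sub>R (- sin w, cos w)"
      by (simp add: c_def prod_eq_iff)
  qed (use l s in auto)
  have sub: "?R' \<subseteq> ?R \<inter> kakeya_set N t"
  proof
    fix p assume "p \<in> ?R'"
    then obtain u v where p: "p = c + h *\<^sub>R (cos w, sin w) + u *\<^sub>R (cos w, sin w) + v *\<^sub>R (- sin w, cos w)"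
      and uv: "0 \<le> u" "u \<le> h" "0 \<le> v" "v \<le> s"
      unfolding rectangle_def by blast
    have "p \<in> ?R"
      unfolding rectangle_def
    proof (rule CollectI, rule exI[of _ "h + u"], rule exI[of _ v], intro conjI)
      show "p = c + (h + u) *\<^sub>R (cos w, sin w) + v *\<^sub>R (- sin w, cos w)"
        by (simp add: p prod_eq_iff distrib_right)
    qed (use uv h hl in auto)
    moreover have "p \<in> strip 0 1 (\<lambda>x. t * kakeya_line N A x) (- (10 * d)) (10 * d)"
    proof -
      define u' where "u' = u * cos w"
      define v' where "v' = v * cos w"
      have u': "0 \<le> u'" "u' \<le> 1 / 2"
      proof -
        have "u * cos w \<le> h * cos w" using uv w by (intro mult_right_mono) auto
        then show "u' \<le> 1 / 2" unfolding u'_def h(2) .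
      qed (use uv w in \<open>simp add: u'_def\<close>)
      have "v' \<le> s * cos w"
        using uv w by (simp add: v'_def)
      also have "\<dots> \<le> 3 * d"
        unfolding s(2) using P0 em ecc_bounds[OF m] by (intro mult_mono) (auto simp: x0_def)
      finally have v': "0 \<le> v'" "v' \<le> 3 * d"
        using uv w by (auto simp: v'_def)
      have sins: "l * sin w = x0 * tan w" "h * sin w = 1 / 2 * tan w" "u * sin w = u' * tan w" "v * sin w = v' * tan w"
        unfolding sin l(2)[symmetric] h(2)[symmetric] u'_def v'_def by (simp_all only: mult_ac)
      have "fst p = x0 - l * cos w + h * cos w + u * cos w - v * sin w"
        by (simp add: p c_def x0_def)
      then have fst: "fst p = 1 / 2 + u' - v' * tan w"
        unfolding sins l(2) h(2) by (simp add: u'_def)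
      have "snd p = snd P - l * sin w + h * sin w + u * sin w + v * cos w"
        by (simp add: p c_def)
      then have snd: "snd p = snd P - (x0 - 1 / 2 - u') * tan w + v'"
        unfolding sins by (simp add: v'_def algebra_simps)
      have vt: "0 \<le> v' * tan w" "v' * tan w \<le> 3 * d"
        using v' tan mult_left_le[of "tan w" v'] by auto
      have "fst p \<in> {0..1}"
        using u' vt d unfolding fst by auto
      have "kakeya_line N A (fst p) = kakeya_line N A x0 - \<sigma> * (x0 - fst p)"
        using kakeya_line_diff[of N A x0 "fst p"] unfolding \<sigma>_def by linarith
      then have "t * kakeya_line N A (fst p) = t * (kakeya_line N A x0 - \<sigma> * (x0 - fst p))"
        by (rule arg_cong)
      \<comment> \<open>The terms are: height of \<open>P\<close> in its tube (at most
        \<open>d / 4\<close>), slope error over a distance at most 3, thickness, and horizontal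
        shift caused by the thickness (at most \<open>3 * d\<close> each).\<close>
      then have eq: "snd p - t * kakeya_line N A (fst p) =
         (snd P - t * kakeya_line N A x0) - (x0 - 1 / 2 - u') * (tan w - t * \<sigma>) + v' + t * \<sigma> * (v' * tan w)"
        unfolding snd fst by (simp add: algebra_simps)
      have "\<bar>(x0 - 1 / 2 - u') * (tan w - t * \<sigma>)\<bar> \<le> 3 * d"
        unfolding abs_mult using slope P0 u' by (intro mult_mono) (auto simp: x0_def w_def)
      moreover have t\<sigma>: "0 \<le> t * \<sigma>" "t * \<sigma> \<le> 1"
        using t \<sigma> by (simp_all add: mult_le_one)
      have "0 \<le> t * \<sigma> * (v' * tan w)"
        by (rule mult_nonneg_nonneg[OF t\<sigma>(1) vt(1)])
      moreover have "t * \<sigma> * (v' * tan w) \<le> 1 * (3 * d)"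
        by (rule mult_mono[OF t\<sigma>(2) vt(2) _ vt(1)]) simp
      ultimately have "\<bar>snd p - t * kakeya_line N A (fst p)\<bar> \<le> 10 * d"
        using P1 v' d unfolding eq x0_def by linarith
      with \<open>fst p \<in> {0..1}\<close> show ?thesis
        unfolding strip_def by (auto simp: abs_le_iff)
    qed
    then have "p \<in> kakeya_set N t"
      using A unfolding kakeya_set_def d_def by (auto simp: mult_ac)
    ultimately show "p \<in> ?R \<inter> kakeya_set N t" by blast
  qed
  have "ennreal (k / 6) \<le> ennreal (k * (h * s) / (l * s))"
  proof (rule ennreal_leI)
    have "l \<le> 6 * h"
      using P0 w by (simp add: l_def h_def x0_def field_simps)
    then have "k * l \<le> k * (6 * h)" using k by (intro mult_left_mono) auto
    then show "k / 6 \<le> k * (h * s) / (l * s)"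
      using s l by (simp add: field_simps)
  qed
  also have "\<dots> = ennreal k * ennreal (h * s) / ennreal (l * s)"
    using k h s l by (simp add: divide_ennreal flip: ennreal_mult)
  also have "ennreal k * ennreal (h * s) = (\<integral>\<^sup>+ y. ennreal k * indicator ?R' y \<partial>lborel)"
    using w h s by (subst nn_integral_cmult_indicator) (auto simp: emeasure_rectangle)
  also have "\<dots> \<le> (\<integral>\<^sup>+ y \<in> ?R. ennreal \<bar>k * indicator (kakeya_set N t) y\<bar> \<partial>lborel)"
    using sub k by (intro nn_integral_mono) (auto simp: indicator_def)
  finally have "ennreal (k / 6) \<le> (\<integral>\<^sup>+ y \<in> ?R. ennreal \<bar>k * indicator (kakeya_set N t) y\<bar> \<partial>lborel) / ennreal (l * s)"
    by (simp add: divide_right_mono_ennreal)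
  also have "\<dots> \<le> maximal_op (rect_family a b) (\<lambda>x. k * indicator (kakeya_set N t) x) P"
    using m l \<open>P \<in> ?R\<close> unfolding s_def w_def by (intro maximal_op_ge) auto
  finally show ?thesis .
qed

lemma unbounded_on_Lp_if_gt:
  assumes "b < a" and p: "1 < p" "p < \<infinity>"
  shows "\<not> bounded_on_Lp p (maximal_op (rect_family a b))"
proof
  let ?M = "maximal_op (rect_family a b)"
  assume "bounded_on_Lp p ?M"
  then obtain B where B: "0 \<le> B" "op_norm p ?M = ennreal B"
    unfolding bounded_on_Lp_def by (cases "op_norm p ?M") auto
  obtain q where p_eq: "p = ennreal q" and q: "1 < q"
    using p by (cases p) (auto simp: ennreal_less_iff simp flip: ennreal_1)
  \<comment> \<open>The measures \<open>t / 2\<close> of the continuations and at most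
    \<open>42 * t / N\<close> of the Kakeya set have ratio at least \<open>N / 84\<close>; the value
    \<open>k / 6\<close> of the maximal function brings in \<open>6 powr q\<close>.\<close>
  have bound: "real N / (84 * 6 powr q) \<le> B powr q" if N: "3 \<le> N" for N
  proof -
    obtain t where t: "0 < t" "t \<le> 1"
      and approx: "\<And>s. 0 \<le> s \<Longrightarrow> s \<le> 1 \<Longrightarrow> \<exists>m\<ge>1. \<bar>tan (angle m) - t * s\<bar> \<le> (1/2) ^ N * t \<and> ecc m \<le> (1/2) ^ N * t"
      using exists_scale[OF \<open>b < a\<close>, of "(1/2) ^ N"] by auto
    let ?K = "kakeya_set N t"
    have "emeasure lborel ?K \<le> ennreal (42 * t / real N)"
      using t N by (intro emeasure_kakeya_set) auto
    then obtain \<mu> where \<mu>: "emeasure lborel ?K = ennreal \<mu>" "0 \<le> \<mu>" "\<mu> \<le> 42 * t / real N"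
      using t by (cases "emeasure lborel ?K") (auto simp: top_unique)
    have "0 < \<mu>"
      using emeasure_kakeya_set_pos[OF t(1), of N] \<mu> by simp
    \<comment> \<open>Normalises \<open>k\<close> times the indicator to norm 1.\<close>
    define k where "k = \<mu> powr (- (1 / q))"
    have k: "0 < k" "k powr q = 1 / \<mu>"
    proof -
      have "k powr q = \<mu> powr (- 1)"
        unfolding k_def powr_powr using q by simp
      then show "k powr q = 1 / \<mu>"
        using \<open>0 < \<mu>\<close> by (simp add: powr_minus_divide)
    qed (use \<open>0 < \<mu>\<close> in \<open>simp add: k_def\<close>)
    define f where "f x = k * indicator ?K x" for x
    have "(\<integral>\<^sup>+ x. epowr (ennreal \<bar>f x\<bar>) q \<partial>lebesgue) = (\<integral>\<^sup>+ x. ennreal (k powr q) * indicator ?K x \<partial>lborel)"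
      unfolding nn_integral_completion using k
      by (intro nn_integral_cong) (auto simp: f_def epowr_def indicator_def)
    also have "\<dots> = 1"
      using k \<mu> \<open>0 < \<mu>\<close> by (subst nn_integral_cmult_indicator) (auto simp flip: ennreal_mult)
    finally have norm: "Lp_norm p (\<lambda>x. ennreal \<bar>f x\<bar>) = 1"
      using q by (simp add: Lp_norm_def p_eq epowr_one)
    have "f \<in> borel_measurable lebesgue"
      unfolding f_def by (intro measurable_completion) simp
    with norm have "Lp_norm p (?M f) \<le> ennreal B"
      unfolding B(2)[symmetric] op_norm_def by (intro SUP_upper) auto
    then have le: "epowr (\<integral>\<^sup>+ x. epowr (?M f x) q \<partial>lborel) (1 / q) \<le> ennreal B"
      using q by (simp add: Lp_norm_def p_eq nn_integral_completion)
    have "ennreal (real N / (84 * 6 powr q)) \<le> ennreal ((k / 6) powr q * (t / 2))"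
    proof (rule ennreal_leI)
      have "real N / 42 \<le> t / \<mu>"
        using \<mu>(3) \<open>0 < \<mu>\<close> N by (simp add: field_simps)
      then have "real N / 42 / (2 * 6 powr q) \<le> t / \<mu> / (2 * 6 powr q)"
        by (rule divide_right_mono) simp
      also have "\<dots> = (k / 6) powr q * (t / 2)"
        using k by (simp add: powr_divide)
      finally show "real N / (84 * 6 powr q) \<le> (k / 6) powr q * (t / 2)"
        by simp
    qed
    also have "\<dots> = (\<integral>\<^sup>+ x. ennreal ((k / 6) powr q) * indicator (kakeya_reach N t) x \<partial>lborel)"
      using t by (subst nn_integral_cmult_indicator)
        (simp_all add: emeasure_kakeya_reach flip: ennreal_mult)
    also have "\<dots> \<le> (\<integral>\<^sup>+ x. epowr (?M f x) q \<partial>lborel)"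
    proof (rule nn_integral_mono)
      fix x
      show "ennreal ((k / 6) powr q) * indicator (kakeya_reach N t) x \<le> epowr (?M f x) q"
      proof (cases "x \<in> kakeya_reach N t")
        case True
        have "ennreal (k / 6) \<le> ?M f x"
          unfolding f_def by (rule maximal_op_kakeya) fact+
        then have "epowr (ennreal (k / 6)) q \<le> epowr (?M f x) q"
          using q by (intro epowr_mono) auto
        with True k show ?thesis by (simp add: epowr_ennreal)
      qed simp
    qed
    also have "\<dots> = epowr (epowr (\<integral>\<^sup>+ x. epowr (?M f x) q \<partial>lborel) (1 / q)) q"
      using q epowr_epowr_inverse[of "1 / q"] by simp
    also have "\<dots> \<le> epowr (ennreal B) q"
      using le q by (intro epowr_mono) auto
    finally show ?thesis
      using B by (simp add: epowr_ennreal)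
  qed
  obtain N :: nat where "84 * 6 powr q * (B powr q + 1) < real N"
    using reals_Archimedean2 by blast
  then have "84 * 6 powr q * (B powr q + 1) < real (max 3 N)" by simp
  then have "B powr q + 1 < real (max 3 N) / (84 * 6 powr q)"
    by (simp add: pos_less_divide_eq mult.commute)
  also have "\<dots> \<le> B powr q"
    by (rule bound) simp
  finally show False by simp
qed

end

theorem theorem7:
  fixes a b :: real
  assumes "a > 0" and "b > 0"
  shows "(a \<le> b \<longrightarrow>
            (\<forall>p::ennreal. 1 < p \<longrightarrow> bounded_on_Lp p (maximal_op (rect_family a b)))) \<and>
         (a > b \<longrightarrow>
            (\<forall>p::ennreal. 1 < p \<and> p < \<infinity> \<longrightarrow> \<not> bounded_on_Lp p (maximal_op (rect_family a b))))"
proof -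
  interpret rectangle_exponents a b
    by unfold_locales fact+
  show ?thesis
    using bounded_on_Lp_if_le unbounded_on_Lp_if_gt by blast
qed

end
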